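(* Assume $\mu_1,\mu_2,\lambda,\tau>0$, $0<c_{\mathrm{pm}}^{\mathrm{uso}}<c_{\mathrm{pm}}^{\mathrm{so}}<c_{\mathrm{cm}}$ and $p\in(0,1)$. Then the optimal policy under the average cost criterion is the following. (a) For condition $2$: do nothing (in all states $(2,\mathrm{USO},t)$, $t\in(0,\tau)$, and $(2,\mathrm{SO},0)$). (b) For condition $1$ at an unscheduled opportunity (all states $(1,\mathrm{USO},t)$, $t\in(0,\tau)$): perform preventive maintenance if $$\mu_1 c_{\mathrm{cm}} > (\mu_1+\mu_2)\frac{c_{\mathrm{pm}}^{\mathrm{uso}}}{p},$$ and do nothing otherwise. (c) For condition $1$ at a scheduled opportunity (state $(1,\mathrm{SO},0)$): perform preventive maintenance if $$\mu_1 c_{\mathrm{cm}} > (\mu_1+\mu_2)\frac{c_{\mathrm{pm}}^{\mathrm{so}}}{p}+\lambda\left(c_{\mathrm{pm}}^{\mathrm{so}}-c_{\mathrm{pm}}^{\mathrm{uso}}\right),$$ and do nothing otherwise.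
   Context: Model. A single-unit system has condition $2$ (perfect) or $1$ (satisfactory). It spends an $\mathrm{Exp}(\mu_i)$ time in condition $i\in\{1,2\}$. From condition $2$ it moves to condition $1$; when the time in condition $1$ expires the system fails and is instantaneously replaced (corrective maintenance, CM, cost $c_{\mathrm{cm}}$), returning to condition $2$. Scheduled opportunities (SO) for preventive maintenance (PM) occur at times $\tau,2\tau,3\tau,\dots$; unscheduled opportunities (USO) occur according to an independent Poisson process of rate $\lambda$. PM costs $c_{\mathrm{pm}}^{\mathrm{so}}$ at an SO and $c_{\mathrm{pm}}^{\mathrm{uso}}$ at a USO. After PM the system is "as good as new" (condition $2$) with probability $p$ and "as bad as old" (unchanged) with probability $q=1-p$, independently of everything else. Semi-Markov decision process. The state space is $$\mathcal S=\{(i,j,t): i\in\{1,2\},\ j\in\{\mathrm{SC},\mathrm{USO}\},\ t\in(0,\tau)\}\cup\{(i,\mathrm{SO},0): i\in\{1,2\}\},$$ where $i$ is the condition, $j$ the type of epoch (SC = the condition is about to change) and $t$ the remaining time until the next SO. Admissible actions $\mathcal A_x$: in $(2,\mathrm{SC},t)$ only "do nothing"; in $(1,\mathrm{SC},t)$ only "perform CM"; in $(i,\mathrm{USO},t)$ and $(i,\mathrm{SO},0)$ either "perform PM" or "do nothing". Immediate costs $c(x;a)$: $0$ for "do nothing", $c_{\mathrm{cm}}$ for CM, $c_{\mathrm{pm}}^{\mathrm{uso}}$ for PM at a USO, $c_{\mathrm{pm}}^{\mathrm{so}}$ for PM at an SO. Dynamics: after the action the condition is $k$, where $k=1$ from $(2,\mathrm{SC},t)$;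 $k=2$ from $(1,\mathrm{SC},t)$; $k=i$ from $(i,\mathrm{USO},t)$ or $(i,\mathrm{SO},0)$ under "do nothing"; and $k=2$ with probability $p$, $k=i$ with probability $1-p$, under "perform PM". Put $r=t$ for SC and USO states and $r=\tau$ for SO states. The next transition time and state then have density $\mu_k e^{-(\lambda+\mu_k)s}$ at $(s,(k,\mathrm{SC},r-s))$ and density $\lambda e^{-(\lambda+\mu_k)s}$ at $(s,(k,\mathrm{USO},r-s))$ for $0<s<r$, and an atom of mass $e^{-(\lambda+\mu_k)r}$ at $(r,(k,\mathrm{SO},0))$. Average cost criterion. Let $X_k,A_k$ be the state and action at the $k$-th transition epoch $T_k$, $T_0=0$. For a policy $\pi$ and initial state $x$, $$J(x,\pi)=\limsup_{n\to\infty}\frac{\mathbb E_x^\pi\left[\sum_{k=0}^{n-1}c(X_k;A_k)\right]}{\mathbb E_x^\pi[T_n]}.$$ A deterministic stationary policy is optimal if it attains $\inf_\pi J(x,\pi)$ over deterministic stationary policies for every $x\in\mathcal S$. *)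

theory Defs
  imports "HOL-Probability.Probability"
begin

datatype cond = Satisfactory | Perfect

datatype epoch = SC | USO | SO

datatype action = Do_Nothing | Perform_PM | Perform_CM

text \<open>
  \<open>mu\<close>: rates of the exponential times spent in the two conditions; \<open>lam\<close>: rate of the Poisson
  process of unscheduled opportunities; \<open>tau\<close>: time between scheduled opportunities;
  \<open>prob_new\<close>: probability that preventive maintenance makes the system as good as new.
\<close>

record model =
  mu :: "cond \<Rightarrow> real"
  lam :: real
  tau :: real
  c_cm :: real
  c_pm_so :: real
  c_pm_uso :: real
  prob_new :: real

type_synonym state = "cond \<times> epoch \<times> real"

definition states :: "model \<Rightarrow> state set" where
  "states m = {(i, j, t) | i j t. j \<in> {SC, USO} \<and> t \<in> {0<..<tau m}} \<union> {(i, SO, 0) | i. True}"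

definition state_space :: "model \<Rightarrow> state measure" where
  "state_space m =
     restrict_space (count_space UNIV \<Otimes>\<^sub>M (count_space UNIV \<Otimes>\<^sub>M borel)) (states m)"

fun admissible :: "state \<Rightarrow> action set" where
  "admissible (Perfect, SC, t) = {Do_Nothing}"
| "admissible (Satisfactory, SC, t) = {Perform_CM}"
| "admissible (i, USO, t) = {Perform_PM, Do_Nothing}"
| "admissible (i, SO, t) = {Perform_PM, Do_Nothing}"

text \<open>Preventive maintenance is not admissible in an SC state, so its value there is irrelevant.\<close>

fun cost :: "model \<Rightarrow> state \<Rightarrow> action \<Rightarrow> real" where
  "cost m x Do_Nothing = 0"
| "cost m x Perform_CM = c_cm m"
| "cost m (i, j, t) Perform_PM = (if j = USO then c_pm_uso m else c_pm_so m)"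

fun cond_after :: "model \<Rightarrow> state \<Rightarrow> action \<Rightarrow> cond pmf" where
  "cond_after m (Perfect, SC, t) a = return_pmf Satisfactory"
| "cond_after m (Satisfactory, SC, t) a = return_pmf Perfect"
| "cond_after m (i, j, t) a =
     (if a = Perform_PM
      then map_pmf (\<lambda>b. if b then Perfect else i) (bernoulli_pmf (prob_new m))
      else return_pmf i)"

fun remaining :: "model \<Rightarrow> state \<Rightarrow> real" where
  "remaining m (i, j, t) = (if j = SO then tau m else t)"

text \<open>
  Joint law of the time until the next epoch and of the state at that epoch, when the condition
  after the action is \<open>k\<close> and the next scheduled opportunity is \<open>r\<close> time units away.
\<close>

definition next_epoch :: "model \<Rightarrow> cond \<Rightarrow> real \<Rightarrow> (real \<times> state) measure" where
  "next_epoch m k r =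
     measure_of (space (borel \<Otimes>\<^sub>M state_space m)) (sets (borel \<Otimes>\<^sub>M state_space m))
       (\<lambda>A. (\<integral>\<^sup>+ s\<in>{0<..<r}. ennreal (mu m k * exp (- (lam m + mu m k) * s))
                              * indicator A (s, (k, SC, r - s)) \<partial>lborel)
          + (\<integral>\<^sup>+ s\<in>{0<..<r}. ennreal (lam m * exp (- (lam m + mu m k) * s))
                              * indicator A (s, (k, USO, r - s)) \<partial>lborel)
          + ennreal (exp (- (lam m + mu m k) * r)) * indicator A (r, (k, SO, 0)))"

definition transition :: "model \<Rightarrow> state \<Rightarrow> action \<Rightarrow> (real \<times> state) measure" where
  "transition m x a =
     measure_pmf (cond_after m x a) \<bind> (\<lambda>k. next_epoch m k (remaining m x))"

text \<open>
  The values of a policy outside \<open>states m\<close> are irrelevant: \<open>states m\<close> is the whole space of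
  \<open>state_space m\<close>. Measurability is needed for the expectations below to make sense.
\<close>

definition policies :: "model \<Rightarrow> (state \<Rightarrow> action) set" where
  "policies m = {f. f \<in> state_space m \<rightarrow>\<^sub>M count_space UNIV \<and> (\<forall>x\<in>states m. f x \<in> admissible x)}"

text \<open>
  A path is a sequence \<open>\<omega>\<close> with \<open>\<omega> n = (T\<^sub>n, X\<^sub>n)\<close>. The conditional law of \<open>(T\<^sub>n, X\<^sub>n)\<close> given the
  first \<open>n\<close> entries is \<open>path_kernel\<close>; the law of the path is obtained from the Ionescu-Tulcea
  theorem (see \<open>Ionescu_Tulcea_path_kernel\<close> below).
\<close>

fun path_kernel ::
  "model \<Rightarrow> (state \<Rightarrow> action) \<Rightarrow> state \<Rightarrow> nat \<Rightarrow> (nat \<Rightarrow> real \<times> state) \<Rightarrow> (real \<times> state) measure" where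
  "path_kernel m f x 0 \<omega> = return (borel \<Otimes>\<^sub>M state_space m) (0, x)"
| "path_kernel m f x (Suc n) \<omega> =
     distr (transition m (snd (\<omega> n)) (f (snd (\<omega> n)))) (borel \<Otimes>\<^sub>M state_space m)
       (\<lambda>(s, y). (fst (\<omega> n) + s, y))"

definition path_law ::
  "model \<Rightarrow> (state \<Rightarrow> action) \<Rightarrow> state \<Rightarrow> (nat \<Rightarrow> real \<times> state) measure" where
  "path_law m f x =
     projective_family.lim UNIV
       (Ionescu_Tulcea.CI (path_kernel m f x) (\<lambda>_. borel \<Otimes>\<^sub>M state_space m))
       (\<lambda>_. borel \<Otimes>\<^sub>M state_space m)"

definition epoch_time :: "nat \<Rightarrow> (nat \<Rightarrow> real \<times> state) \<Rightarrow> real" where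
  "epoch_time n \<omega> = fst (\<omega> n)"

definition epoch_state :: "nat \<Rightarrow> (nat \<Rightarrow> real \<times> state) \<Rightarrow> state" where
  "epoch_state n \<omega> = snd (\<omega> n)"

definition average_cost :: "model \<Rightarrow> state \<Rightarrow> (state \<Rightarrow> action) \<Rightarrow> ereal" where
  "average_cost m x f =
     limsup (\<lambda>n. ereal
       ((\<integral>\<omega>. (\<Sum>k<n. cost m (epoch_state k \<omega>) (f (epoch_state k \<omega>))) \<partial>path_law m f x)
        / (\<integral>\<omega>. epoch_time n \<omega> \<partial>path_law m f x)))"

definition optimal_policy :: "model \<Rightarrow> (state \<Rightarrow> action) \<Rightarrow> bool" where
  "optimal_policy m f \<longleftrightarrow>
     f \<in> policies m \<and>
     (\<forall>x\<in>states m. average_cost m x f = (INF g\<in>policies m. average_cost m x g))"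


subsection \<open>Well-definedness of the path law\<close>

lemma states_iff:
  "(i, j, t) \<in> states m \<longleftrightarrow> (if j = SO then t = 0 else 0 < t \<and> t < tau m)"
  by (cases j) (auto simp: states_def)

lemma sets_states: "states m \<in> sets (count_space UNIV \<Otimes>\<^sub>M (count_space UNIV \<Otimes>\<^sub>M borel))"
proof -
  have "states m = UNIV \<times> ({SC, USO} \<times> {0<..<tau m}) \<union> UNIV \<times> ({SO} \<times> {0})"
    by (auto simp: states_def)
  also have "\<dots> \<in> sets (count_space UNIV \<Otimes>\<^sub>M (count_space UNIV \<Otimes>\<^sub>M borel))"
    by (intro sets.Un pair_measureI) auto
  finally show ?thesis .
qed

lemma space_state_space [simp]: "space (state_space m) = states m"
  by (simp add: state_space_def space_restrict_space space_pair_measure)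

lemma sets_epoch_space:
  assumes "A \<in> sets (borel \<Otimes>\<^sub>M state_space m)"
  shows "A \<in> sets ((borel :: real measure) \<Otimes>\<^sub>M (count_space UNIV \<Otimes>\<^sub>M (count_space UNIV \<Otimes>\<^sub>M borel)))"
    (is "_ \<in> sets ?M")
proof -
  have "A \<in> sigma_sets (UNIV \<times> states m) {a \<times> b |a b. a \<in> sets borel \<and> b \<in> sets (state_space m)}"
    using assms by (simp add: sets_pair_measure)
  then show ?thesis
  proof (induction rule: sigma_sets.induct)
    case (Basic a)
    then show ?case
      using sets_states by (auto simp: state_space_def sets_restrict_space intro!: pair_measureI)
  next
    case (Compl a)
    have "UNIV \<times> states m \<in> sets ?M"
      using sets_states by (intro pair_measureI) auto
    with Compl show ?case by auto
  qed auto
qed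

text \<open>The three summands of the mass that \<open>next_epoch\<close> assigns to \<open>A\<close>.\<close>

abbreviation next_epoch_mass ::
  "model \<Rightarrow> cond \<Rightarrow> real \<Rightarrow> (real \<times> state) set \<Rightarrow> ennreal" where
  "next_epoch_mass m k r A \<equiv>
     (\<integral>\<^sup>+ s\<in>{0<..<r}. ennreal (mu m k * exp (- (lam m + mu m k) * s))
                      * indicator A (s, (k, SC, r - s)) \<partial>lborel)
   + (\<integral>\<^sup>+ s\<in>{0<..<r}. ennreal (lam m * exp (- (lam m + mu m k) * s))
                      * indicator A (s, (k, USO, r - s)) \<partial>lborel)
   + ennreal (exp (- (lam m + mu m k) * r)) * indicator A (r, (k, SO, 0))"

lemma measurable_indicator_epoch:
  assumes "A \<in> sets (borel \<Otimes>\<^sub>M state_space m)"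
  shows "(\<lambda>(r, s). indicator A (s, (k, j, r - s)) :: ennreal) \<in> borel_measurable (borel \<Otimes>\<^sub>M lborel)"
proof -
  note [measurable] = sets_epoch_space[OF assms]
  show ?thesis by measurable
qed

lemma measurable_indicator_epoch':
  assumes "A \<in> sets (borel \<Otimes>\<^sub>M state_space m)"
  shows "(\<lambda>s. indicator A (s, (k, j, r - s)) :: ennreal) \<in> borel_measurable lborel"
proof -
  note [measurable] = sets_epoch_space[OF assms]
  show ?thesis by measurable
qed

lemma suminf_indicator_mult:
  fixes c :: ennreal
  assumes "disjoint_family A"
  shows "(\<Sum>i. c * indicator (A i) x) = c * indicator (\<Union>i. A i) x"
  using suminf_indicator[OF assms] by simp

lemma emeasure_next_epoch:
  assumes A: "A \<in> sets (borel \<Otimes>\<^sub>M state_space m)"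
  shows "emeasure (next_epoch m k r) A = next_epoch_mass m k r A"
proof (rule emeasure_measure_of[OF next_epoch_def])
  let ?S = "sets (borel \<Otimes>\<^sub>M state_space m)"
  show "?S \<subseteq> Pow (space (borel \<Otimes>\<^sub>M state_space m))"
    by (rule sets.space_closed)
  show "A \<in> sets (next_epoch m k r)"
    using A by (simp add: next_epoch_def sets.sets_measure_of_eq)
  show "positive (sets (next_epoch m k r)) (next_epoch_mass m k r)"
    by (simp add: positive_def)
  show "countably_additive (sets (next_epoch m k r)) (next_epoch_mass m k r)"
  proof (rule countably_additiveI)
    fix A :: "nat \<Rightarrow> (real \<times> state) set"
    assume "range A \<subseteq> sets (next_epoch m k r)" and disj: "disjoint_family A"
    then have A: "A i \<in> ?S" for i
      by (auto simp: next_epoch_def sets.sets_measure_of_eq)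
    note [measurable] = measurable_indicator_epoch'[OF A]
    have sum_int: "(\<Sum>i. \<integral>\<^sup>+ s\<in>{0<..<r}. ennreal (c * exp (- (lam m + mu m k) * s))
                          * indicator (A i) (s, (k, j, r - s)) \<partial>lborel)
        = (\<integral>\<^sup>+ s\<in>{0<..<r}. ennreal (c * exp (- (lam m + mu m k) * s))
                          * indicator (\<Union>i. A i) (s, (k, j, r - s)) \<partial>lborel)" for c j
      by (subst nn_integral_suminf[symmetric])
         (auto intro!: nn_integral_cong simp: suminf_indicator_mult[OF disj]
               simp del: ennreal_suminf_cmult)
    show "(\<Sum>i. next_epoch_mass m k r (A i)) = next_epoch_mass m k r (\<Union>i. A i)"
      by (simp only: suminf_add[OF summableI summableI, symmetric] sum_int
          suminf_indicator_mult[OF disj])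
  qed
qed

lemma space_next_epoch [simp]: "space (next_epoch m k r) = UNIV \<times> states m"
  using space_measure_of[OF sets.space_closed, of "borel \<Otimes>\<^sub>M state_space m"]
  by (simp add: next_epoch_def space_pair_measure)

lemma sets_next_epoch [simp, measurable_cong]:
  "sets (next_epoch m k r) = sets (borel \<Otimes>\<^sub>M state_space m)"
  by (simp add: next_epoch_def sets.sets_measure_of_eq)

lemma prob_space_next_epoch:
  assumes "mu m k > 0" "lam m > 0" "0 < r" "r \<le> tau m"
  shows "prob_space (next_epoch m k r)"
proof (rule prob_spaceI)
  let ?c = "lam m + mu m k"
  have int: "(\<integral>\<^sup>+ s\<in>{0<..<r}. ennreal (b * exp (- ?c * s))
                 * indicator (UNIV \<times> states m) (s, (k, j, r - s)) \<partial>lborel)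
        = ennreal (b * ((1 - exp (- ?c * r)) / ?c))" if "b > 0" "j \<noteq> SO" for b j
  proof -
    have deriv: "((\<lambda>s. - (b / ?c) * exp (- ?c * s)) has_real_derivative b * exp (- ?c * s)) (at s)" for s
    proof -
      have "- (b / ?c) * (exp (- ?c * s) * (- ?c)) = b * exp (- ?c * s)"
        using assms by (simp add: field_simps)
      moreover have "((\<lambda>s. - (b / ?c) * exp (- ?c * s)) has_real_derivative
          - (b / ?c) * (exp (- ?c * s) * (- ?c))) (at s)"
        by (rule derivative_eq_intros refl | simp)+
      ultimately show ?thesis by simp
    qed
    have "(\<integral>\<^sup>+ s\<in>{0<..<r}. ennreal (b * exp (- ?c * s))
                 * indicator (UNIV \<times> states m) (s, (k, j, r - s)) \<partial>lborel)
        = (\<integral>\<^sup>+ s. ennreal (b * exp (- ?c * s)) * indicator {0..r} s \<partial>lborel)"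
    proof (rule nn_integral_cong_AE)
      show "AE s in lborel. ennreal (b * exp (- ?c * s))
                 * indicator (UNIV \<times> states m) (s, (k, j, r - s)) * indicator {0<..<r} s
          = ennreal (b * exp (- ?c * s)) * indicator {0..r} s"
        using AE_lborel_singleton[of 0] AE_lborel_singleton[of r]
      proof eventually_elim
        case (elim s)
        then show ?case using assms that by (auto simp: states_iff indicator_def)
      qed
    qed
    also have "\<dots> = ennreal ((- (b / ?c) * exp (- ?c * r)) - (- (b / ?c) * exp (- ?c * 0)))"
      using assms that
      by (intro nn_integral_FTC_Icc deriv[THEN has_field_derivative_at_within]) auto
    also have "(- (b / ?c) * exp (- ?c * r)) - (- (b / ?c) * exp (- ?c * 0))
        = b * ((1 - exp (- ?c * r)) / ?c)"
      by (simp add: right_diff_distrib diff_divide_distrib)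
    finally show ?thesis .
  qed
  have le: "exp (- ?c * r) \<le> 1"
    using assms by (simp add: mult_nonpos_nonneg)
  have "emeasure (next_epoch m k r) (UNIV \<times> states m)
      = ennreal (mu m k * ((1 - exp (- ?c * r)) / ?c)) + ennreal (lam m * ((1 - exp (- ?c * r)) / ?c))
        + ennreal (exp (- ?c * r))"
    using sets.top[of "borel \<Otimes>\<^sub>M state_space m"] assms int
    by (subst emeasure_next_epoch) (auto simp: space_pair_measure states_iff)
  also have "\<dots> = ennreal (mu m k * ((1 - exp (- ?c * r)) / ?c)
        + lam m * ((1 - exp (- ?c * r)) / ?c) + exp (- ?c * r))"
    using assms le by (simp add: ennreal_plus[symmetric] del: ennreal_plus)
  also have "mu m k * ((1 - exp (- ?c * r)) / ?c)
        + lam m * ((1 - exp (- ?c * r)) / ?c) + exp (- ?c * r) = 1"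
  proof -
    have "a * ((1 - E) / (l + a)) + l * ((1 - E) / (l + a)) + E = 1"
      if "a > 0" "l > 0" for a l E :: real
      using that by (simp add: divide_simps) (simp add: algebra_simps)
    then show ?thesis using assms by blast
  qed
  finally show "emeasure (next_epoch m k r) (space (next_epoch m k r)) = 1" by simp
qed

lemma measurable_next_epoch:
  assumes "mu m k > 0" "lam m > 0"
  shows "next_epoch m k \<in> restrict_space borel {0<..tau m} \<rightarrow>\<^sub>M
           subprob_algebra (borel \<Otimes>\<^sub>M state_space m)"
proof (rule measurable_subprob_algebra)
  show "subprob_space (next_epoch m k r)" if "r \<in> space (restrict_space borel {0<..tau m})" for r
    using that assms
    by (intro prob_space_imp_subprob_space prob_space_next_epoch) (auto simp: space_restrict_space)
next
  fix A :: "(real \<times> state) set" assume A: "A \<in> sets (borel \<Otimes>\<^sub>M state_space m)"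
  note [measurable] = measurable_indicator_epoch[OF A] sets_epoch_space[OF A]
  have [measurable]: "(\<lambda>r. \<integral>\<^sup>+ s\<in>{0<..<r}. ennreal (b * exp (- (lam m + mu m k) * s))
            * indicator A (s, (k, j, r - s)) \<partial>lborel) \<in> borel_measurable borel" for b j
  proof -
    have "(\<lambda>r. \<integral>\<^sup>+ s. (ennreal (b * exp (- (lam m + mu m k) * s))
            * indicator A (s, (k, j, r - s))) * (if 0 < s \<and> s < r then 1 else 0) \<partial>lborel)
          \<in> borel_measurable borel"
      by measurable
    then show ?thesis
      by (simp add: indicator_def)
  qed
  show "(\<lambda>r. emeasure (next_epoch m k r) A) \<in> borel_measurable (restrict_space borel {0<..tau m})"
    unfolding emeasure_next_epoch[OF A]
    by (intro measurable_restrict_space1) measurable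
qed simp

lemma remaining_bounds:
  "tau m > 0 \<Longrightarrow> x \<in> states m \<Longrightarrow> 0 < remaining m x \<and> remaining m x \<le> tau m"
  by (cases x) (auto simp: states_iff split: if_splits)

lemma measurable_state_components [measurable]:
  "fst \<in> state_space m \<rightarrow>\<^sub>M count_space UNIV"
  "(\<lambda>x. fst (snd x)) \<in> state_space m \<rightarrow>\<^sub>M count_space UNIV"
  "(\<lambda>x. snd (snd x)) \<in> borel_measurable (state_space m)"
  unfolding state_space_def by (intro measurable_restrict_space1; measurable)+

lemma measurable_remaining:
  assumes "tau m > 0"
  shows "remaining m \<in> state_space m \<rightarrow>\<^sub>M restrict_space borel {0<..tau m}"
proof (rule measurable_restrict_space2)
  have "remaining m = (\<lambda>x. if fst (snd x) = SO then tau m else snd (snd x))"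
    by (auto simp: fun_eq_iff)
  then show "remaining m \<in> borel_measurable (state_space m)"
    by simp
qed (use assms remaining_bounds in auto)

lemma cond_after_cong: "cond_after m x a = cond_after m (fst x, fst (snd x), 0) a"
  by (cases "(m, x, a)" rule: cond_after.cases) auto

instance cond :: countable by countable_datatype
instance epoch :: countable by countable_datatype
instance action :: countable by countable_datatype

lemma measurable_transition:
  assumes pos: "\<And>k. mu m k > 0" "lam m > 0" "tau m > 0" and f: "f \<in> policies m"
  shows "(\<lambda>x. transition m x (f x)) \<in> state_space m \<rightarrow>\<^sub>M subprob_algebra (borel \<Otimes>\<^sub>M state_space m)"
  unfolding transition_def
proof (rule measurable_bind)
  have [measurable]: "f \<in> state_space m \<rightarrow>\<^sub>M count_space UNIV"
    using f by (simp add: policies_def)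
  have "(\<lambda>(i, j, a). measure_pmf (cond_after m (i, j, 0) a))
      \<in> count_space UNIV \<rightarrow>\<^sub>M subprob_algebra (count_space UNIV)"
    by (auto simp: space_subprob_algebra intro!: prob_space_imp_subprob_space prob_space_measure_pmf)
  moreover have "(\<lambda>x. (fst x, fst (snd x), f x)) \<in> state_space m \<rightarrow>\<^sub>M count_space UNIV"
  proof -
    have "(\<lambda>x. (fst x, fst (snd x), f x))
        \<in> state_space m \<rightarrow>\<^sub>M count_space UNIV \<Otimes>\<^sub>M (count_space UNIV \<Otimes>\<^sub>M count_space UNIV)"
      by measurable
    then show ?thesis by (simp add: pair_measure_countable)
  qed
  ultimately have "(\<lambda>x. measure_pmf (cond_after m (fst x, fst (snd x), 0) (f x)))
      \<in> state_space m \<rightarrow>\<^sub>M subprob_algebra (count_space UNIV)"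
    by (rule measurable_compose[rotated, THEN measurable_cong[THEN iffD1, rotated]]) simp
  then show "(\<lambda>x. measure_pmf (cond_after m x (f x)))
      \<in> state_space m \<rightarrow>\<^sub>M subprob_algebra (count_space UNIV)"
    by (subst cond_after_cong)
next
  show "(\<lambda>y. next_epoch m (snd y) (remaining m (fst y)))
      \<in> state_space m \<Otimes>\<^sub>M count_space UNIV \<rightarrow>\<^sub>M subprob_algebra (borel \<Otimes>\<^sub>M state_space m)"
    by (rule measurable_compose_countable'[where I = UNIV and g = snd
            and f = "\<lambda>k y. next_epoch m k (remaining m (fst y))"])
       (auto intro!: measurable_compose[OF measurable_fst]
          measurable_compose[OF measurable_remaining measurable_next_epoch] pos)
qed

lemma measurable_next_epoch_cond:
  assumes "\<And>k. mu m k > 0" "lam m > 0" "tau m > 0" "x \<in> states m"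
  shows "(\<lambda>k. next_epoch m k (remaining m x))
           \<in> measure_pmf M \<rightarrow>\<^sub>M subprob_algebra (borel \<Otimes>\<^sub>M state_space m)"
  using assms remaining_bounds[of m x]
  by (auto simp: space_subprob_algebra intro!: prob_space_imp_subprob_space prob_space_next_epoch)

lemma prob_space_transition:
  assumes "\<And>k. mu m k > 0" "lam m > 0" "tau m > 0" "x \<in> states m"
  shows "prob_space (transition m x a)"
  unfolding transition_def
  using assms remaining_bounds[of m x]
  by (intro prob_space.prob_space_bind[OF prob_space_measure_pmf _ measurable_next_epoch_cond])
     (auto intro!: AE_I2 prob_space_next_epoch)

theorem Ionescu_Tulcea_path_kernel:
  assumes pos: "\<And>k. mu m k > 0" "lam m > 0" "tau m > 0" and f: "f \<in> policies m" and x: "x \<in> states m"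
  shows "Ionescu_Tulcea (path_kernel m f x) (\<lambda>_. borel \<Otimes>\<^sub>M state_space m)"
proof (rule Ionescu_Tulcea.intro)
  let ?M = "\<lambda>_::nat. (borel :: real measure) \<Otimes>\<^sub>M state_space m"
  note tr = measurable_transition[OF pos f]
  have sets_tr: "sets (transition m y (f y)) = sets (borel \<Otimes>\<^sub>M state_space m)" if "y \<in> states m" for y
    using subprob_measurableD(2)[OF tr] that by simp
  show "path_kernel m f x i \<in> Pi\<^sub>M {0..<i} ?M \<rightarrow>\<^sub>M subprob_algebra (?M i)" for i
  proof (cases i)
    case 0
    have "path_kernel m f x 0 = (\<lambda>_. return (borel \<Otimes>\<^sub>M state_space m) (0, x))"
      by (simp add: fun_eq_iff)
    with 0 show ?thesis
      using x by (simp add: space_pair_measure space_subprob_algebra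
        prob_space_imp_subprob_space prob_space_return)
  next
    case (Suc n)
    have comp [measurable]: "(\<lambda>\<omega>. \<omega> n) \<in> Pi\<^sub>M {0..<i} ?M \<rightarrow>\<^sub>M borel \<Otimes>\<^sub>M state_space m"
      using Suc by (intro measurable_component_singleton) auto
    have "(\<lambda>\<omega>. distr (transition m (snd (\<omega> n)) (f (snd (\<omega> n)))) (borel \<Otimes>\<^sub>M state_space m)
            (\<lambda>(s, y). (fst (\<omega> n) + s, y)))
        \<in> Pi\<^sub>M {0..<i} ?M \<rightarrow>\<^sub>M subprob_algebra (borel \<Otimes>\<^sub>M state_space m)"
    proof (rule measurable_distr2[where M = "borel \<Otimes>\<^sub>M state_space m"])
      have [measurable]: "(\<lambda>z. fst (fst z n)) \<in> borel_measurable
          (Pi\<^sub>M {0..<i} ?M \<Otimes>\<^sub>M (borel \<Otimes>\<^sub>M state_space m))"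
        by (intro measurable_compose[OF measurable_compose[OF measurable_fst comp] measurable_fst])
      have "(\<lambda>z. (fst (fst z n) + fst (snd z), snd (snd z)))
          \<in> Pi\<^sub>M {0..<i} ?M \<Otimes>\<^sub>M (borel \<Otimes>\<^sub>M state_space m) \<rightarrow>\<^sub>M borel \<Otimes>\<^sub>M state_space m"
        by (intro measurable_Pair borel_measurable_add) measurable
      then show "(\<lambda>(\<omega>, s, y). (fst (\<omega> n) + s, y))
          \<in> Pi\<^sub>M {0..<i} ?M \<Otimes>\<^sub>M (borel \<Otimes>\<^sub>M state_space m) \<rightarrow>\<^sub>M borel \<Otimes>\<^sub>M state_space m"
        by (simp add: case_prod_unfold)
      show "(\<lambda>\<omega>. transition m (snd (\<omega> n)) (f (snd (\<omega> n))))
          \<in> Pi\<^sub>M {0..<i} ?M \<rightarrow>\<^sub>M subprob_algebra (borel \<Otimes>\<^sub>M state_space m)"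
        by (rule measurable_compose[OF measurable_compose[OF comp measurable_snd] tr])
    qed
    moreover have "path_kernel m f x i = (\<lambda>\<omega>. distr (transition m (snd (\<omega> n)) (f (snd (\<omega> n))))
        (borel \<Otimes>\<^sub>M state_space m) (\<lambda>(s, y). (fst (\<omega> n) + s, y)))"
      using Suc by (simp add: fun_eq_iff)
    ultimately show ?thesis by simp
  qed
  show "prob_space (path_kernel m f x i \<omega>)" 
    if "\<omega> \<in> space (Pi\<^sub>M {0..<i} ?M)" for \<omega> and i :: nat
  proof (cases i)
    case 0
    then show ?thesis
      using x by (auto simp: space_pair_measure intro!: prob_space_return)
  next
    case (Suc n)
    with that have "\<omega> n \<in> space (borel \<Otimes>\<^sub>M state_space m)"
      by (auto simp: space_PiM PiE_iff)
    then have y: "snd (\<omega> n) \<in> states m"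
      by (auto simp: space_pair_measure)
    have "(\<lambda>(s, y). (fst (\<omega> n) + s, y))
        \<in> transition m (snd (\<omega> n)) (f (snd (\<omega> n))) \<rightarrow>\<^sub>M borel \<Otimes>\<^sub>M state_space m"
      by (subst measurable_cong_sets[OF sets_tr[OF y] refl]) measurable
    then show ?thesis
      using prob_space_transition[OF pos y] Suc
      by (auto intro!: prob_space.prob_space_distr)
  qed
qed

end

theory Submission
  imports Defs
begin

text \<open>
  The policy is shown to be optimal by solving the average cost optimality equation explicitly.
  Suppose that a number \<open>g\<close> and a bounded function \<open>h\<close> satisfy
  \<open>h y \<le> cost y a + E[h (next state) - g * sojourn time | y, a]\<close> for every admissible \<open>a\<close>, with equality
  for the action that a policy \<open>f\<close> takes. Summing along a path, the expected cost of the first \<open>n\<close>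
  epochs is at least \<open>g\<close> times the expected time of epoch \<open>n\<close>, up to a constant, whatever the policy,
  and equals it up to a constant for \<open>f\<close>. Expected epoch times tend to infinity, so \<open>g\<close> bounds all
  average costs from below and is the average cost of \<open>f\<close>. This is
  \<open>optimal_policy_if_optimality_equation\<close>; the divergence of the epoch times is
  \<open>mean_time_growth\<close>, an instance of the same argument (\<open>drift\<close>).

  For the solution, let \<open>v k t\<close> be the relative value in condition \<open>k\<close> when the next scheduled
  opportunity is \<open>t\<close> away. Conditioning on the next epoch and differentiating in \<open>t\<close> turns the optimality
  equation into differential equations on \<open>[0, tau]\<close>, with a condition that links \<open>v k 0\<close> to
  \<open>v k tau\<close> through the decision at the scheduled opportunity (\<open>integral_next_epoch\<close> and
  \<open>optimal_policy_if_ode\<close>). Only the difference \<open>D t = v Satisfactory t - v Perfect t\<close>, the cost of being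
  in the worse condition, matters for the decisions: maintenance at price \<open>c\<close> removes the excess \<open>D\<close> with
  probability \<open>p = prob_new\<close>, so it is worthwhile iff \<open>c \<le> p * D\<close>. Write \<open>c_uso\<close> and \<open>c_so\<close> for the two
  prices. With \<open>M = mu Satisfactory + mu Perfect\<close> and
  \<open>K = mu Satisfactory * c_cm\<close>, it satisfies
  \<open>D' = K - M * D + lam * min 0 (c_uso - p * D)\<close> and \<open>D 0 = D tau + min 0 (c_so - p * D tau)\<close>.
  If maintenance at scheduled opportunities does not pay, \<open>D\<close> is the constant equilibrium of the
  differential equation: \<open>K / M\<close> without maintenance at unscheduled opportunities, which is consistent
  iff \<open>p * K \<le> M * c_uso\<close>, and \<open>d = (K + lam * c_uso) / (M + lam * p)\<close> with it. The criterion for scheduled opportunities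
  says exactly that \<open>c_so < p * d\<close>; then \<open>D\<close> is pushed below \<open>d\<close> by a jump at each scheduled opportunity
  and returns to \<open>d\<close> exponentially, staying above \<open>c_so / p\<close> throughout, so that all decisions remain the
  ones assumed.
\<close>

section \<open>The next epoch\<close>

lemma nn_integral_sum_measure:
  assumes sets: "sets A = sets N" "sets B = sets N" "sets C = sets N"
    and sum: "\<And>X. X \<in> sets N \<Longrightarrow> emeasure N X = emeasure A X + emeasure B X + emeasure C X"
    and u: "u \<in> borel_measurable N"
  shows "integral\<^sup>N N u = integral\<^sup>N A u + integral\<^sup>N B u + integral\<^sup>N C u"
proof -
  note [measurable_cong] = sets
  have space: "space A = space N" "space B = space N" "space C = space N"
    using sets by (auto dest: sets_eq_imp_space_eq)
  show ?thesis
    using u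
  proof (induction rule: borel_measurable_induct)
    case (cong f g)
    have "integral\<^sup>N K f = integral\<^sup>N K g" if "space K = space N" for K
      using cong(3) that by (intro nn_integral_cong) auto
    with cong(4) space show ?case by metis
  next
    case (set X)
    then show ?case using sets sum by simp
  next
    case (mult u c)
    have [measurable]: "u \<in> borel_measurable N" by fact
    show ?case
      using mult.IH by (simp add: nn_integral_cmult distrib_left)
  next
    case (add u v)
    have [measurable]: "u \<in> borel_measurable N" "v \<in> borel_measurable N" by fact+
    show ?case
      using add.IH by (simp add: nn_integral_add ac_simps)
  next
    case (seq U)
    have [measurable]: "U i \<in> borel_measurable N" for i by fact
    have sup: "integral\<^sup>N K (Sup (range U)) = (SUP i. integral\<^sup>N K (U i))"
      if "sets K = sets N" for K
    proof -
      have "U i \<in> borel_measurable K" for i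
        using that by (simp cong: measurable_cong_sets)
      moreover have "Sup (range U) = (\<lambda>x. SUP i. U i x)"
        by (auto simp: fun_eq_iff image_comp)
      ultimately show ?thesis
        using nn_integral_monotone_convergence_SUP[OF \<open>incseq U\<close>] by simp
    qed
    have inc: "incseq (\<lambda>i. integral\<^sup>N K (U i))" for K
      using \<open>incseq U\<close> by (auto simp: incseq_def le_fun_def intro!: nn_integral_mono)
    show ?case
      unfolding sup[OF sets(1)] sup[OF sets(2)] sup[OF sets(3)] sup[OF refl] seq.IH
      by (simp add: ennreal_SUP_add[symmetric] inc incseq_def add_mono incseqD[OF inc])
  qed
qed

instance cond :: finite
proof
  show "finite (UNIV :: cond set)"
    by (rule finite_subset[of _ "{Satisfactory, Perfect}"]) (use cond.exhaust in auto)
qed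

locale maintenance =
  fixes m :: model
  assumes mu_pos: "0 < mu m k" and lam_pos: "0 < lam m" and tau_pos: "0 < tau m"
    and prob_new: "0 < prob_new m" "prob_new m < 1"
begin

abbreviation epochs :: "(real \<times> state) measure" where
  "epochs \<equiv> borel \<Otimes>\<^sub>M state_space m"

abbreviation exit_rate :: "cond \<Rightarrow> real" where
  "exit_rate k \<equiv> lam m + mu m k"

lemma exit_rate_pos: "0 < exit_rate k"
  using lam_pos mu_pos[of k] by simp

lemma measurable_state_function:
  fixes h :: "state \<Rightarrow> real"
  assumes "\<And>k j. (\<lambda>t. h (k, j, t)) \<in> borel_measurable borel"
  shows "h \<in> borel_measurable (state_space m)"
proof -
  have "(\<lambda>x. h (fst x, fst (snd x), snd (snd x))) \<in> borel_measurable (state_space m)"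
  proof (rule measurable_compose_countable[where g = fst])
    fix k
    show "(\<lambda>x. h (k, fst (snd x), snd (snd x))) \<in> borel_measurable (state_space m)"
    proof (rule measurable_compose_countable[where g = "\<lambda>x. fst (snd x)"])
      show "(\<lambda>x. h (k, j, snd (snd x))) \<in> borel_measurable (state_space m)" for j
        by (rule measurable_compose[OF measurable_state_components(3) assms])
    qed simp
  qed simp
  then show ?thesis by simp
qed

lemma bound_on_states:
  fixes h :: "state \<Rightarrow> real"
  assumes "\<And>k j t. 0 \<le> t \<Longrightarrow> t \<le> tau m \<Longrightarrow> \<bar>h (k, j, t)\<bar> \<le> B" and "y \<in> states m"
  shows "\<bar>h y\<bar> \<le> B"
proof -
  obtain k j t where y: "y = (k, j, t)" by (metis prod.collapse)
  with assms(2) have "0 \<le> t \<and> t \<le> tau m"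
    using tau_pos by (auto simp: states_iff split: if_splits)
  with assms(1) y show ?thesis by blast
qed

text \<open>
  The mass of a set under \<open>next_epoch\<close> is by definition a sum of three terms. Each is the mass under an
  ordinary measure, the image of a density or a scaled point mass, so the same formula holds for
  integrals of arbitrary functions.
\<close>
lemma next_epoch_decomposition:
  assumes r: "0 < r" "r \<le> tau m" and u [measurable]: "u \<in> borel_measurable epochs"
  shows "(\<integral>\<^sup>+ z. u z \<partial>next_epoch m k r) =
      (\<integral>\<^sup>+ s\<in>{0<..<r}. ennreal (mu m k * exp (- exit_rate k * s)) * u (s, (k, SC, r - s)) \<partial>lborel)
    + (\<integral>\<^sup>+ s\<in>{0<..<r}. ennreal (lam m * exp (- exit_rate k * s)) * u (s, (k, USO, r - s)) \<partial>lborel)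
    + ennreal (exp (- exit_rate k * r)) * u (r, (k, SO, 0))"
proof -
  define d where "d b s = ennreal (b * exp (- exit_rate k * s)) * indicator {0<..<r} s" for b s
  have d [measurable]: "d b \<in> borel_measurable borel" for b
    unfolding d_def by measurable
  \<comment> \<open>Outside \<open>{0<..<r}\<close>, where the density vanishes, any state serves as a value of \<open>e\<close>.\<close>
  define e where "e j s = (if 0 < s \<and> s < r then (s, (k, j, r - s)) else (r, (k, SO, 0)))" for j s
  have e [measurable]: "e j \<in> borel \<rightarrow>\<^sub>M epochs" if "j \<noteq> SO" for j
  proof -
    have "fst \<circ> e j \<in> borel_measurable borel"
      unfolding e_def comp_def by (simp add: if_distrib[of fst] cong: if_cong)
    moreover have "snd \<circ> e j \<in> borel \<rightarrow>\<^sub>M state_space m"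
      unfolding state_space_def
    proof (rule measurable_restrict_space2)
      show "snd \<circ> e j \<in> space borel \<rightarrow> states m"
        using that r by (auto simp: e_def states_iff)
      show "snd \<circ> e j \<in> borel \<rightarrow>\<^sub>M count_space UNIV \<Otimes>\<^sub>M (count_space UNIV \<Otimes>\<^sub>M borel)"
        unfolding e_def comp_def by (simp add: if_distrib[of snd] cong: if_cong)
    qed
    ultimately show ?thesis by (rule measurable_pair)
  qed
  have SO: "(r, (k, SO, 0)) \<in> space epochs"
    by (simp add: space_pair_measure states_iff)
  define D where "D b j = distr (density lborel (d b)) epochs (e j)" for b j
  define A where "A = scale_measure (ennreal (exp (- exit_rate k * r))) (return epochs (r, (k, SO, 0)))"
  have D: "(\<integral>\<^sup>+ z. w z \<partial>D b j) =
      (\<integral>\<^sup>+ s\<in>{0<..<r}. ennreal (b * exp (- exit_rate k * s)) * w (s, (k, j, r - s)) \<partial>lborel)"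
    if "j \<noteq> SO" "w \<in> borel_measurable epochs" for b j w
  proof -
    note [measurable] = that(2) e[OF that(1)]
    have "(\<integral>\<^sup>+ z. w z \<partial>D b j) = (\<integral>\<^sup>+ s. d b s * w (e j s) \<partial>lborel)"
      unfolding D_def by (simp add: nn_integral_distr nn_integral_density)
    then show ?thesis
      by (auto simp: d_def e_def indicator_def intro!: nn_integral_cong elim!: trans)
  qed
  have A: "(\<integral>\<^sup>+ z. w z \<partial>A) = ennreal (exp (- exit_rate k * r)) * w (r, (k, SO, 0))"
    if "w \<in> borel_measurable epochs" for w
    using that SO by (simp add: A_def nn_integral_scale_measure nn_integral_return)
  have sets: "sets (D b j) = sets epochs" "sets A = sets epochs" for b j
    by (simp_all add: D_def A_def)
  have "integral\<^sup>N (next_epoch m k r) u =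
      integral\<^sup>N (D (mu m k) SC) u + integral\<^sup>N (D (lam m) USO) u + integral\<^sup>N A u"
  proof (rule nn_integral_sum_measure)
    fix X assume "X \<in> sets (next_epoch m k r)"
    then have X: "X \<in> sets epochs" by simp
    have "emeasure (D b j) X = (\<integral>\<^sup>+ s\<in>{0<..<r}. ennreal (b * exp (- exit_rate k * s))
        * indicator X (s, (k, j, r - s)) \<partial>lborel)" if "j \<noteq> SO" for b j
      using D[OF that, of "indicator X"] X sets by (simp add: nn_integral_indicator)
    moreover have "emeasure A X = ennreal (exp (- exit_rate k * r)) * indicator X (r, (k, SO, 0))"
      using A[of "indicator X"] X sets by (simp add: nn_integral_indicator)
    ultimately show "emeasure (next_epoch m k r) X =
        emeasure (D (mu m k) SC) X + emeasure (D (lam m) USO) X + emeasure A X"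
      using emeasure_next_epoch[OF X, of k r] by simp
  qed (simp_all add: sets)
  then show ?thesis
    using D[of SC u "mu m k"] D[of USO u "lam m"] A[of u] u by simp
qed

lemma prob_next_epoch: "0 < r \<Longrightarrow> r \<le> tau m \<Longrightarrow> prob_space (next_epoch m k r)"
  using prob_space_next_epoch mu_pos lam_pos by blast

lemma AE_next_epoch:
  assumes r: "0 < r" "r \<le> tau m"
  shows "AE z in next_epoch m k r. 0 \<le> fst z \<and> fst z \<le> r"
proof -
  define X where "X = {z \<in> space epochs. \<not> (0 \<le> fst z \<and> fst z \<le> r)}"
  have X [measurable]: "X \<in> sets epochs"
    unfolding X_def by measurable
  have "(\<integral>\<^sup>+ s\<in>{0<..<r}. c s * indicator X (s, (k, j, r - s)) \<partial>lborel) = 0"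
    for c :: "real \<Rightarrow> ennreal" and j
    by (intro nn_integral_zero' AE_I2) (auto simp: X_def indicator_def)
  moreover have "indicator X (r, (k, SO, 0)) = (0 :: ennreal)"
    using r by (auto simp: X_def indicator_def)
  ultimately have null: "emeasure (next_epoch m k r) X = 0"
    unfolding emeasure_next_epoch[OF X] by simp
  show ?thesis
  proof (rule AE_I[OF _ null])
    show "{z \<in> space (next_epoch m k r). \<not> (0 \<le> fst z \<and> fst z \<le> r)} \<subseteq> X"
      by (auto simp: X_def space_pair_measure)
  qed (simp add: X)
qed

text \<open>
  First-step analysis in differential form. Integrating the equation for \<open>v\<close> against the factor
  \<open>exp (- exit_rate k * s)\<close> yields the expectation over the next epoch as an integral over \<open>[0, r]\<close>,
  with the initial value of \<open>v\<close> as the contribution of reaching the scheduled opportunity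
  undisturbed. This is how both solutions of the optimality equation and the lower bound on expected epoch
  times are obtained without computing integrals.
\<close>
lemma integral_next_epoch:
  fixes h :: "state \<Rightarrow> real" and v :: "real \<Rightarrow> real"
  assumes r: "0 < r" "r \<le> tau m"
    and meas: "\<And>k j. (\<lambda>t. h (k, j, t)) \<in> borel_measurable borel"
    and bound: "\<And>k j t. 0 \<le> t \<Longrightarrow> t \<le> tau m \<Longrightarrow> \<bar>h (k, j, t)\<bar> \<le> B"
    and deriv: "\<And>t. 0 \<le> t \<Longrightarrow> t \<le> tau m \<Longrightarrow> (v has_real_derivative
        mu m k * h (k, SC, t) + lam m * h (k, USO, t) - exit_rate k * v t + a) (at t)"
    and init: "v 0 = h (k, SO, 0)"
  shows "(\<integral>z. a * fst z + h (snd z) \<partial>next_epoch m k r) = v r"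
proof -
  let ?b = "exit_rate k"
  interpret prob_space "next_epoch m k r" by (rule prob_next_epoch[OF r])
  note [measurable] = meas measurable_state_function[OF meas]
  have b: "0 < ?b" by (rule exit_rate_pos)
  \<comment> \<open>Adding \<open>C\<close> makes the integrand nonnegative, so that the fundamental theorem of calculus for
    nonnegative functions applies.\<close>
  define C where "C = \<bar>a\<bar> * r + B"
  have pos: "0 \<le> C + (a * s + h (k, j, t))" if "0 \<le> s" "s \<le> r" "0 \<le> t" "t \<le> tau m" for s j t k
  proof -
    have "- (a * s) \<le> \<bar>a\<bar> * r"
      using that mult_mono[of "\<bar>a\<bar>" "\<bar>a\<bar>" s r] abs_mult[of a s] by auto
    with bound[of t k j] that show ?thesis by (simp add: C_def abs_le_iff)
  qed
  have bnd: "\<bar>a * s + h (k, j, t)\<bar> \<le> C" if "0 \<le> s" "s \<le> r" "0 \<le> t" "t \<le> tau m" for s j t k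
  proof -
    have "\<bar>a * s\<bar> \<le> \<bar>a\<bar> * r"
      using that by (auto simp: abs_mult intro!: mult_left_mono)
    with bound[of t k j] that show ?thesis by (simp add: C_def abs_le_iff)
  qed
  have bnd': "\<bar>a * fst z + h (snd z)\<bar> \<le> C" if "0 \<le> fst z \<and> fst z \<le> r" "z \<in> UNIV \<times> states m" for z
  proof -
    obtain s k j t where z: "z = (s, (k, j, t))" by (metis prod.collapse)
    with that(2) have "0 \<le> t \<and> t \<le> tau m"
      using tau_pos by (auto simp: states_iff split: if_splits)
    with bnd[of s t k j] that z show ?thesis by auto
  qed
  have AE: "AE z in next_epoch m k r. \<bar>a * fst z + h (snd z)\<bar> \<le> C"
    using AE_next_epoch[OF r] AE_space
    by eventually_elim (use bnd' in \<open>auto\<close>)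
  have int: "integrable (next_epoch m k r) (\<lambda>z. a * fst z + h (snd z))"
    using AE by (intro integrable_const_bound[where B = C]) auto
  define f where "f j s = exp (- ?b * s) * (C + (a * s + h (k, j, r - s)))" for j s
  \<comment> \<open>The antiderivative: minus the discounted value of still being without an event after time \<open>s\<close>.\<close>
  define F where "F s = - exp (- ?b * s) * (C + a * s + v (r - s))" for s
  have f [measurable]: "f j \<in> borel_measurable borel" for j
  proof -
    have "(\<lambda>s. h (k, j, r - s)) \<in> borel_measurable borel"
      by (rule measurable_compose[OF _ meas]) simp
    then show ?thesis unfolding f_def by measurable
  qed
  have dF: "DERIV F s :> mu m k * f SC s + lam m * f USO s" if "0 \<le> s" "s \<le> r" for s
  proof -
    have "((\<lambda>s. v (r - s)) has_real_derivative
        - (mu m k * h (k, SC, r - s) + lam m * h (k, USO, r - s) - ?b * v (r - s) + a)) (at s)"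
    proof -
      have "((\<lambda>s. r - s) has_real_derivative - 1) (at s)"
        by (auto intro!: derivative_eq_intros)
      from DERIV_chain2[OF deriv this] that r show ?thesis by simp
    qed
    then show ?thesis
      unfolding F_def f_def
      by (auto intro!: derivative_eq_intros) (simp add: algebra_simps)
  qed
  have F_mono: "0 \<le> F r - F 0"
  proof -
    have "F 0 \<le> F r"
    proof (rule DERIV_nonneg_imp_nondecreasing[of 0 r F])
      fix s assume s: "0 \<le> s" "s \<le> r"
      then have "0 \<le> mu m k * f SC s + lam m * f USO s"
        using r lam_pos mu_pos[of k] pos[of s "r - s" k]
        by (auto simp: f_def intro!: add_nonneg_nonneg mult_nonneg_nonneg)
      with dF[OF s] show "\<exists>y. DERIV F s :> y \<and> 0 \<le> y" by blast
    qed (use r in simp)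
    then show ?thesis by simp
  qed
  have atom: "0 \<le> exp (- ?b * r) * (C + (a * r + h (k, SO, 0)))"
    using pos[of r 0 k SO] r tau_pos by simp
  have total: "F r - F 0 + exp (- ?b * r) * (C + (a * r + h (k, SO, 0))) = C + v r"
    by (simp add: F_def init algebra_simps)
  have "(\<integral>\<^sup>+ z. ennreal (C + (a * fst z + h (snd z))) \<partial>next_epoch m k r) =
      (\<integral>\<^sup>+ s\<in>{0<..<r}. ennreal (mu m k * exp (- ?b * s)) * ennreal (C + (a * s + h (k, SC, r - s))) \<partial>lborel)
    + (\<integral>\<^sup>+ s\<in>{0<..<r}. ennreal (lam m * exp (- ?b * s)) * ennreal (C + (a * s + h (k, USO, r - s))) \<partial>lborel)
    + ennreal (exp (- ?b * r)) * ennreal (C + (a * r + h (k, SO, 0)))"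
    using next_epoch_decomposition[OF r, of "\<lambda>z. ennreal (C + (a * fst z + h (snd z)))" k] by simp
  also have "\<dots> = (\<integral>\<^sup>+ s. ennreal (mu m k * f SC s + lam m * f USO s) * indicator {0..r} s \<partial>lborel)
      + ennreal (exp (- ?b * r) * (C + (a * r + h (k, SO, 0))))"
  proof -
    have "(\<integral>\<^sup>+ s\<in>{0<..<r}. ennreal (c * exp (- ?b * s)) * ennreal (C + (a * s + h (k, j, r - s))) \<partial>lborel)
        = (\<integral>\<^sup>+ s. ennreal (c * f j s) * indicator {0..r} s \<partial>lborel)" if "0 < c" for c j
    proof (rule nn_integral_cong_AE)
      show "AE s in lborel. ennreal (c * exp (- ?b * s)) * ennreal (C + (a * s + h (k, j, r - s))) * indicator {0<..<r} s
          = ennreal (c * f j s) * indicator {0..r} s"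
        using AE_lborel_singleton[of 0] AE_lborel_singleton[of r]
      proof eventually_elim
        case (elim s)
        have "ennreal (c * exp (- ?b * s)) * ennreal (C + (a * s + h (k, j, r - s))) = ennreal (c * f j s)"
          using that by (simp add: f_def ennreal_mult'[symmetric] mult.assoc)
        with elim show ?case by (auto simp: indicator_def)
      qed
    qed
    moreover have "ennreal (mu m k * f SC s + lam m * f USO s) * indicator {0..r} s =
        ennreal (mu m k * f SC s) * indicator {0..r} s + ennreal (lam m * f USO s) * indicator {0..r} s"
      for s
      using pos[of s "r - s" k] r lam_pos mu_pos[of k]
      by (auto simp: indicator_def f_def intro!: ennreal_plus)
    moreover have "ennreal (exp (- ?b * r)) * ennreal (C + (a * r + h (k, SO, 0)))
        = ennreal (exp (- ?b * r) * (C + (a * r + h (k, SO, 0))))"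
      by (simp add: ennreal_mult')
    ultimately show ?thesis
      using mu_pos[of k] lam_pos by (simp add: nn_integral_add)
  qed
  also have "(\<integral>\<^sup>+ s. ennreal (mu m k * f SC s + lam m * f USO s) * indicator {0..r} s \<partial>lborel) = ennreal (F r - F 0)"
    using r lam_pos mu_pos[of k] pos
    by (intro nn_integral_FTC_Icc dF) (auto simp: f_def intro!: add_nonneg_nonneg mult_nonneg_nonneg)
  also have "\<dots> + ennreal (exp (- ?b * r) * (C + (a * r + h (k, SO, 0)))) = ennreal (C + v r)"
    using ennreal_plus[OF F_mono atom] by (simp only: total)
  finally have nn: "(\<integral>\<^sup>+ z. ennreal (C + (a * fst z + h (snd z))) \<partial>next_epoch m k r) = ennreal (C + v r)" .
  have nonneg: "AE z in next_epoch m k r. 0 \<le> C + (a * fst z + h (snd z))"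
    using AE by eventually_elim auto
  have "ennreal (\<integral>z. C + (a * fst z + h (snd z)) \<partial>next_epoch m k r) = ennreal (C + v r)"
    using nn nonneg int by (subst nn_integral_eq_integral[symmetric]) auto
  moreover have "(\<integral>z. C + (a * fst z + h (snd z)) \<partial>next_epoch m k r) = C + (\<integral>z. a * fst z + h (snd z) \<partial>next_epoch m k r)"
    using int prob_space by simp
  moreover have "0 \<le> C + v r"
    using F_mono atom total by linarith
  moreover have "0 \<le> (\<integral>z. C + (a * fst z + h (snd z)) \<partial>next_epoch m k r)"
    using nonneg by (rule integral_nonneg_AE)
  ultimately show ?thesis by simp
qed

end

section \<open>Marginals of the Ionescu-Tulcea measure\<close>

lemma (in Ionescu_Tulcea) up_to_atLeastLessThan: "up_to {0..<n} = n"
proof (rule antisym)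
  show "n \<le> up_to {0..<n}"
    using up_to[of "{0..<n}"] by auto
qed (simp add: up_to_iff_Ico)

lemma (in Ionescu_Tulcea) distr_lim_initial_segment:
  "distr PF.lim (PiM {0..<n} M) (\<lambda>\<omega>. restrict \<omega> {0..<n}) = C 0 n (\<lambda>_. undefined)"
proof -
  have *: "(\<lambda>_. undefined) \<in> space (PiM {0..<0} M)" by (simp add: space_PiM)
  have "distr PF.lim (PiM {0..<n} M) (\<lambda>\<omega>. restrict \<omega> {0..<n})
      = distr (C 0 n (\<lambda>_. undefined)) (PiM {0..<n} M) (\<lambda>\<omega>. restrict \<omega> {0..<n})"
    by (simp add: distr_lim CI_def up_to_atLeastLessThan)
  also have "\<dots> = C 0 n (\<lambda>_. undefined)"
    using distr_C[of n n "\<lambda>_. undefined" 0] * by simp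
  finally show ?thesis .
qed

lemma (in Ionescu_Tulcea) measurable_restrict_lim:
  "(\<lambda>\<omega>. restrict \<omega> {0..<n}) \<in> PF.lim \<rightarrow>\<^sub>M PiM {0..<n} M"
  by (subst measurable_cong_sets[OF PF.sets_lim refl])
     (auto intro!: measurable_restrict measurable_component_singleton)

text \<open>
  The kernel \<open>P n\<close> is the conditional law of coordinate \<open>n\<close> given the earlier ones. Costs and times are
  additive along a path, so expectations of functions of a single coordinate are all that is needed, and
  this recursion determines them.
\<close>
lemma (in Ionescu_Tulcea) distr_lim_component:
  "distr PF.lim (M n) (\<lambda>\<omega>. \<omega> n) = PF.lim \<bind> (\<lambda>\<omega>. P n (restrict \<omega> {0..<n}))"
proof (rule measure_eqI)
  have u: "(\<lambda>_. undefined) \<in> space (PiM {0..<0} M)" by (simp add: space_PiM)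
  have comp [measurable]: "(\<lambda>\<omega>. \<omega> n) \<in> PiM {0..<Suc n} M \<rightarrow>\<^sub>M M n"
    by (rule measurable_component_singleton) simp
  have comp' [measurable]: "(\<lambda>\<omega>. \<omega> n) \<in> PF.lim \<rightarrow>\<^sub>M M n"
    by (subst measurable_cong_sets[OF PF.sets_lim refl]) (rule measurable_component_singleton, simp)
  note res [measurable] = measurable_restrict_lim
  have K: "(\<lambda>\<omega>. P n (restrict \<omega> {0..<n})) \<in> PF.lim \<rightarrow>\<^sub>M subprob_algebra (M n)"
    by (rule measurable_compose[OF res P])
  have ne: "space PF.lim \<noteq> {}"
    using space_PiM_not_empty PF.space_lim by simp
  show sets: "sets (distr PF.lim (M n) (\<lambda>\<omega>. \<omega> n)) = sets (PF.lim \<bind> (\<lambda>\<omega>. P n (restrict \<omega> {0..<n})))"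
    using sets_bind[OF sets_kernel[OF K] ne] by simp
  fix A assume "A \<in> sets (distr PF.lim (M n) (\<lambda>\<omega>. \<omega> n))"
  then have A [measurable]: "A \<in> sets (M n)" by simp
  have "emeasure (distr PF.lim (M n) (\<lambda>\<omega>. \<omega> n)) A
      = (\<integral>\<^sup>+ y. indicator A y \<partial>distr PF.lim (M n) (\<lambda>\<omega>. \<omega> n))"
    by simp
  also have "\<dots> = (\<integral>\<^sup>+ \<omega>. indicator A (\<omega> n) \<partial>PF.lim)"
    by (rule nn_integral_distr) auto
  also have "\<dots> = (\<integral>\<^sup>+ \<omega>. indicator A (restrict \<omega> {0..<Suc n} n) \<partial>PF.lim)"
    by simp
  also have "\<dots> = (\<integral>\<^sup>+ \<omega>. indicator A (\<omega> n) \<partial>C 0 (Suc n) (\<lambda>_. undefined))"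
    unfolding distr_lim_initial_segment[symmetric]
    by (subst nn_integral_distr[OF measurable_restrict_lim]) auto
  also have "\<dots> = (\<integral>\<^sup>+ \<omega>. (\<integral>\<^sup>+ \<omega>'. indicator A (\<omega>' n) \<partial>eP n \<omega>) \<partial>C 0 n (\<lambda>_. undefined))"
    using u by (simp, subst nn_integral_bind[where B = "PiM {0..<Suc n} M"])
       (auto simp: measurable_cong_sets[OF sets_C[OF u] refl])
  also have "\<dots> = (\<integral>\<^sup>+ \<omega>. emeasure (P n \<omega>) A \<partial>C 0 n (\<lambda>_. undefined))"
  proof (rule nn_integral_cong)
    fix \<omega> assume "\<omega> \<in> space (C 0 n (\<lambda>_. undefined))"
    then have \<omega>: "\<omega> \<in> space (PiM {0..<n} M)" using space_C[OF u] by simp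
    show "(\<integral>\<^sup>+ \<omega>'. indicator A (\<omega>' n) \<partial>eP n \<omega>) = emeasure (P n \<omega>) A"
      using sets_P[OF \<omega>] by (simp add: nn_integral_eP[OF \<omega>] A)
  qed
  also have "\<dots> = (\<integral>\<^sup>+ \<omega>. emeasure (P n (restrict \<omega> {0..<n})) A \<partial>PF.lim)"
    unfolding distr_lim_initial_segment[symmetric]
    by (subst nn_integral_distr[OF measurable_restrict_lim]) auto
  also have "\<dots> = emeasure (PF.lim \<bind> (\<lambda>\<omega>. P n (restrict \<omega> {0..<n}))) A"
    by (rule emeasure_bind[OF ne K A, symmetric])
  finally show "emeasure (distr PF.lim (M n) (\<lambda>\<omega>. \<omega> n)) A = \<dots>" .
qed

section \<open>One transition\<close>

context maintenance
begin

lemma prob_transition: "x \<in> states m \<Longrightarrow> prob_space (transition m x a)"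
  using prob_space_transition mu_pos lam_pos tau_pos by blast

lemma remaining: "x \<in> states m \<Longrightarrow> 0 < remaining m x" "x \<in> states m \<Longrightarrow> remaining m x \<le> tau m"
  using remaining_bounds[OF tau_pos] by auto

lemma kernel_cond_after:
  "x \<in> states m \<Longrightarrow>
    (\<lambda>k. next_epoch m k (remaining m x)) \<in> measure_pmf M \<rightarrow>\<^sub>M subprob_algebra epochs"
  using measurable_next_epoch_cond[of m x M] mu_pos lam_pos tau_pos by simp

lemma sets_transition: "x \<in> states m \<Longrightarrow> sets (transition m x a) = sets epochs"
  unfolding transition_def by (rule sets_bind) auto

lemma space_transition: "x \<in> states m \<Longrightarrow> space (transition m x a) = UNIV \<times> states m"
  using sets_eq_imp_space_eq[OF sets_transition] by (simp add: space_pair_measure)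

lemma AE_transition:
  assumes x: "x \<in> states m"
  shows "AE z in transition m x a. 0 \<le> fst z \<and> fst z \<le> tau m"
proof -
  have "AE z in next_epoch m k (remaining m x). 0 \<le> fst z \<and> fst z \<le> tau m" for k
    using AE_next_epoch[OF remaining[OF x], of k] by eventually_elim (use remaining[OF x] in auto)
  then show ?thesis
    unfolding transition_def by (subst AE_bind[OF kernel_cond_after[OF x]]) auto
qed

text \<open>
  The rule for integrals over \<open>bind\<close> wants a bounded integrand. Sojourn times are bounded only almost
  surely, hence the truncation at \<open>tau m\<close> in this proof and the similar one in \<open>integral_path_Suc\<close>.
\<close>
lemma integral_transition:
  fixes h :: "state \<Rightarrow> real"
  assumes x: "x \<in> states m" and h [measurable]: "h \<in> borel_measurable (state_space m)"
    and bound: "\<And>y. y \<in> states m \<Longrightarrow> \<bar>h y\<bar> \<le> B"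
  shows "(\<integral>z. b * fst z + h (snd z) \<partial>transition m x a) =
      (\<integral>k. (\<integral>z. b * fst z + h (snd z) \<partial>next_epoch m k (remaining m x)) \<partial>cond_after m x a)"
proof -
  define u where "u z = b * max 0 (min (fst z) (tau m)) + h (snd z)" for z
  have u [measurable]: "u \<in> borel_measurable epochs"
    unfolding u_def by measurable
  have ae: "AE z in next_epoch m k (remaining m x). b * fst z + h (snd z) = u z" for k
    using AE_next_epoch[OF remaining[OF x], of k]
    by eventually_elim (use remaining[OF x] in \<open>auto simp: u_def\<close>)
  have ae': "AE z in transition m x a. b * fst z + h (snd z) = u z"
    using AE_transition[OF x] by eventually_elim (auto simp: u_def)
  note [measurable_cong] = sets_transition[OF x]
  have "(\<integral>z. b * fst z + h (snd z) \<partial>transition m x a) = (\<integral>z. u z \<partial>transition m x a)"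
    by (intro integral_cong_AE ae') measurable
  also have "\<dots> = (\<integral>k. (\<integral>z. u z \<partial>next_epoch m k (remaining m x)) \<partial>cond_after m x a)"
    unfolding transition_def
  proof (rule integral_bind[OF u _ kernel_cond_after[OF x], where B' = 1])
    fix z assume "z \<in> space epochs"
    then have "snd z \<in> states m" by (auto simp: space_pair_measure)
    moreover have "\<bar>b * max 0 (min (fst z) (tau m))\<bar> \<le> \<bar>b\<bar> * tau m"
      using tau_pos by (auto simp: abs_mult intro!: mult_left_mono)
    ultimately show "\<bar>u z\<bar> \<le> \<bar>b\<bar> * tau m + B"
      unfolding u_def by (intro order_trans[OF abs_triangle_ineq add_mono] bound)
  qed (use prob_space.emeasure_space_1[OF prob_next_epoch[OF remaining[OF x]]] in
      \<open>auto intro: measure_pmf.finite_measure simp del: space_next_epoch\<close>)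
  also have "\<dots> = (\<integral>k. (\<integral>z. b * fst z + h (snd z) \<partial>next_epoch m k (remaining m x)) \<partial>cond_after m x a)"
  proof (rule Bochner_Integration.integral_cong[OF refl])
    fix k
    show "(\<integral>z. u z \<partial>next_epoch m k (remaining m x)) =
        (\<integral>z. b * fst z + h (snd z) \<partial>next_epoch m k (remaining m x))"
      using ae[of k] by (intro integral_cong_AE) (auto elim!: eventually_mono)
  qed
  finally show ?thesis .
qed

lemma integrable_transition:
  fixes h :: "state \<Rightarrow> real"
  assumes x: "x \<in> states m" and h [measurable]: "h \<in> borel_measurable (state_space m)"
    and bound: "\<And>y. y \<in> states m \<Longrightarrow> \<bar>h y\<bar> \<le> B"
  shows "integrable (transition m x a) (\<lambda>z. b * fst z + h (snd z))"
proof -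
  interpret prob_space "transition m x a" by (rule prob_transition[OF x])
  note [measurable_cong] = sets_transition[OF x]
  have "AE z in transition m x a. norm (b * fst z + h (snd z)) \<le> \<bar>b\<bar> * tau m + B"
    using AE_transition[OF x] AE_space
  proof eventually_elim
    case (elim z)
    then have "snd z \<in> states m" by (auto simp: space_transition[OF x])
    moreover have "\<bar>b * fst z\<bar> \<le> \<bar>b\<bar> * tau m"
      using elim by (auto simp: abs_mult intro!: mult_left_mono)
    ultimately show ?case
      unfolding real_norm_def by (intro order_trans[OF abs_triangle_ineq add_mono] bound)
  qed
  then show ?thesis by (rule integrable_const_bound) measurable
qed

end

section \<open>Paths under a stationary policy\<close>

locale controlled = maintenance +
  fixes f :: "state \<Rightarrow> action" and x :: state
  assumes policy: "f \<in> policies m" and start: "x \<in> states m"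
begin

sublocale IT: Ionescu_Tulcea "path_kernel m f x" "\<lambda>_. epochs"
  using Ionescu_Tulcea_path_kernel mu_pos lam_pos tau_pos policy start by blast

abbreviation path :: "(nat \<Rightarrow> real \<times> state) measure" where
  "path \<equiv> path_law m f x"

lemma sets_path [measurable_cong]: "sets path = sets (PiM UNIV (\<lambda>_. epochs))"
  unfolding path_law_def by (rule IT.PF.sets_lim)

lemma space_path: "space path = UNIV \<rightarrow>\<^sub>E UNIV \<times> states m"
  using sets_eq_imp_space_eq[OF sets_path] by (simp add: space_PiM space_pair_measure)

lemma measurable_epoch [measurable]: "(\<lambda>\<omega>. \<omega> n) \<in> path \<rightarrow>\<^sub>M epochs"
  by measurable

sublocale path: prob_space path
proof -
  have "prob_space (distr path (PiM {} (\<lambda>_. epochs)) (\<lambda>\<omega>. restrict \<omega> {}))"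
    using IT.distr_lim[of "{}"] IT.PF.prob_space_P[of "{}"] by (simp add: path_law_def)
  then show "prob_space path"
    by (rule prob_space_distrD[rotated]) (auto intro!: measurable_restrict)
qed

lemma measurable_transition_policy:
  "(\<lambda>y. transition m y (f y)) \<in> state_space m \<rightarrow>\<^sub>M subprob_algebra epochs"
  using measurable_transition mu_pos lam_pos tau_pos policy by blast

text \<open>
  The path kernel depends on the past only through the last epoch; this is that dependence.
\<close>
definition shifted_transition :: "real \<times> state \<Rightarrow> (real \<times> state) measure" where
  "shifted_transition w = distr (transition m (snd w) (f (snd w))) epochs (\<lambda>z. (fst w + fst z, snd z))"

lemma measurable_shifted_transition [measurable]:
  "shifted_transition \<in> epochs \<rightarrow>\<^sub>M subprob_algebra epochs"
  unfolding shifted_transition_def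
proof (rule measurable_distr2[where M = epochs])
  show "(\<lambda>y. transition m (snd y) (f (snd y))) \<in> epochs \<rightarrow>\<^sub>M subprob_algebra epochs"
    by (rule measurable_compose[OF measurable_snd measurable_transition_policy])
qed measurable

lemma prob_shifted_transition: "snd w \<in> states m \<Longrightarrow> prob_space (shifted_transition w)"
  unfolding shifted_transition_def
  by (rule prob_space.prob_space_distr[OF prob_transition])
     (auto simp: measurable_cong_sets[OF sets_transition refl])

lemma sets_shifted_transition: "sets (shifted_transition w) = sets epochs"
  by (simp add: shifted_transition_def)

lemma measurable_shift:
  assumes y: "y \<in> states m"
  shows "(\<lambda>z. (t + fst z, snd z)) \<in> transition m y a \<rightarrow>\<^sub>M epochs"
  unfolding measurable_cong_sets[OF sets_transition[OF y] refl] by measurable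

lemma integral_shifted_transition:
  fixes u :: "real \<times> state \<Rightarrow> real"
  assumes "snd w \<in> states m" and "u \<in> borel_measurable epochs"
  shows "(\<integral>z. u z \<partial>shifted_transition w) =
    (\<integral>z. u (fst w + fst z, snd z) \<partial>transition m (snd w) (f (snd w)))"
  unfolding shifted_transition_def by (rule integral_distr[OF measurable_shift]) fact+

lemma AE_shifted_transition:
  assumes w: "snd w \<in> states m"
  shows "AE z in shifted_transition w. fst w \<le> fst z \<and> fst z \<le> fst w + tau m"
  unfolding shifted_transition_def
proof (subst AE_distr_iff[OF measurable_shift[OF w]])
  show "AE z in transition m (snd w) (f (snd w)).
      fst w \<le> fst (fst w + fst z, snd z) \<and> fst (fst w + fst z, snd z) \<le> fst w + tau m"
    using AE_transition[OF w] by eventually_elim auto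
qed measurable

lemma distr_path_Suc:
  "distr path epochs (\<lambda>\<omega>. \<omega> (Suc n)) = path \<bind> (\<lambda>\<omega>. shifted_transition (\<omega> n))"
  using IT.distr_lim_component[of "Suc n"]
  by (simp add: path_law_def shifted_transition_def case_prod_unfold)

lemma distr_path_0: "distr path epochs (\<lambda>\<omega>. \<omega> 0) = return epochs (0, x)"
proof -
  have "path \<bind> (\<lambda>_. return epochs (0, x)) = return epochs (0, x)"
    using start by (intro bind_const') (auto intro!: path.prob_space_axioms prob_space_imp_subprob_space prob_space_return simp: space_pair_measure)
  then show ?thesis
    using IT.distr_lim_component[of 0] by (simp add: path_law_def)
qed

lemma AE_path_states: "AE \<omega> in path. \<forall>n. snd (\<omega> n) \<in> states m"
  using AE_space by eventually_elim (auto simp: space_path PiE_iff mem_Times_iff)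

lemma AE_path_time: "AE \<omega> in path. 0 \<le> fst (\<omega> n) \<and> fst (\<omega> n) \<le> n * tau m"
proof (induction n)
  case 0
  have "AE w in distr path epochs (\<lambda>\<omega>. \<omega> 0). fst w = 0"
    using start unfolding distr_path_0 by (subst AE_return) (auto simp: space_pair_measure)
  then show ?case by (subst (asm) AE_distr_iff) auto
next
  case (Suc n)
  have "AE w in path \<bind> (\<lambda>\<omega>. shifted_transition (\<omega> n)). 0 \<le> fst w \<and> fst w \<le> Suc n * tau m"
  proof (subst AE_bind[where B = epochs])
    show "AE \<omega> in path. AE w in shifted_transition (\<omega> n). 0 \<le> fst w \<and> fst w \<le> Suc n * tau m"
      using Suc AE_path_states
    proof eventually_elim
      case (elim \<omega>)
      have "AE w in shifted_transition (\<omega> n). fst (\<omega> n) \<le> fst w \<and> fst w \<le> fst (\<omega> n) + tau m"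
        using elim by (intro AE_shifted_transition) simp
      then show ?case
        by eventually_elim (use elim(1) in \<open>auto simp: algebra_simps\<close>)
    qed
  qed measurable
  then show ?case
    unfolding distr_path_Suc[symmetric] by (subst (asm) AE_distr_iff) auto
qed

lemma integrable_path:
  fixes h :: "state \<Rightarrow> real"
  assumes h [measurable]: "h \<in> borel_measurable (state_space m)"
    and bound: "\<And>y. y \<in> states m \<Longrightarrow> \<bar>h y\<bar> \<le> B"
  shows "integrable path (\<lambda>\<omega>. b * fst (\<omega> n) + h (snd (\<omega> n)))"
proof -
  have "AE \<omega> in path. norm (b * fst (\<omega> n) + h (snd (\<omega> n))) \<le> \<bar>b\<bar> * (n * tau m) + B"
    using AE_path_time[of n] AE_path_states
  proof eventually_elim
    case (elim \<omega>)
    then have "\<bar>b * fst (\<omega> n)\<bar> \<le> \<bar>b\<bar> * (n * tau m)"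
      by (auto simp: abs_mult intro!: mult_left_mono)
    moreover have "snd (\<omega> n) \<in> states m" using elim by simp
    ultimately show ?case
      unfolding real_norm_def by (intro order_trans[OF abs_triangle_ineq add_mono] bound)
  qed
  then show ?thesis by (rule path.integrable_const_bound) measurable
qed

lemma integral_path_Suc:
  fixes h :: "state \<Rightarrow> real"
  assumes h [measurable]: "h \<in> borel_measurable (state_space m)"
    and bound: "\<And>y. y \<in> states m \<Longrightarrow> \<bar>h y\<bar> \<le> B"
  shows "(\<integral>\<omega>. b * fst (\<omega> (Suc n)) + h (snd (\<omega> (Suc n))) \<partial>path) =
    (\<integral>\<omega>. b * fst (\<omega> n) + (\<integral>z. b * fst z + h (snd z) \<partial>transition m (snd (\<omega> n)) (f (snd (\<omega> n)))) \<partial>path)"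
proof -
  define c where "c = Suc n * tau m"
  have c: "0 \<le> c" using tau_pos by (simp add: c_def)
  define u where "u w = b * max 0 (min (fst w) c) + h (snd w)" for w
  have u [measurable]: "u \<in> borel_measurable epochs"
    unfolding u_def by measurable
  have "(\<integral>\<omega>. b * fst (\<omega> (Suc n)) + h (snd (\<omega> (Suc n))) \<partial>path) = (\<integral>\<omega>. u (\<omega> (Suc n)) \<partial>path)"
  proof (rule integral_cong_AE)
    show "AE \<omega> in path. b * fst (\<omega> (Suc n)) + h (snd (\<omega> (Suc n))) = u (\<omega> (Suc n))"
      using AE_path_time[of "Suc n"] by eventually_elim (auto simp: u_def c_def)
  qed measurable
  also have "\<dots> = (\<integral>w. u w \<partial>(path \<bind> (\<lambda>\<omega>. shifted_transition (\<omega> n))))"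
    unfolding distr_path_Suc[symmetric] by (subst integral_distr) measurable
  also have "\<dots> = (\<integral>\<omega>. (\<integral>w. u w \<partial>shifted_transition (\<omega> n)) \<partial>path)"
  proof (rule integral_bind[OF u, where B' = 1])
    fix w assume "w \<in> space epochs"
    then have "snd w \<in> states m" by (auto simp: space_pair_measure)
    moreover have "\<bar>b * max 0 (min (fst w) c)\<bar> \<le> \<bar>b\<bar> * c"
      using c by (auto simp: abs_mult intro!: mult_left_mono)
    ultimately show "\<bar>u w\<bar> \<le> \<bar>b\<bar> * c + B"
      unfolding u_def by (intro order_trans[OF abs_triangle_ineq add_mono] bound)
  next
    show "AE \<omega> in path. emeasure (shifted_transition (\<omega> n)) (space (shifted_transition (\<omega> n))) \<le> ennreal 1"
      using AE_path_states
      by eventually_elim (use prob_space.emeasure_space_1[OF prob_shifted_transition] in auto)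
  qed (auto intro: path.finite_measure_axioms)
  also have "\<dots> = (\<integral>\<omega>. b * fst (\<omega> n) + (\<integral>z. b * fst z + h (snd z) \<partial>transition m (snd (\<omega> n)) (f (snd (\<omega> n)))) \<partial>path)"
  proof (rule integral_cong_AE)
    show "AE \<omega> in path. (\<integral>w. u w \<partial>shifted_transition (\<omega> n)) =
        b * fst (\<omega> n) + (\<integral>z. b * fst z + h (snd z) \<partial>transition m (snd (\<omega> n)) (f (snd (\<omega> n))))"
      using AE_path_time[of n] AE_path_states
    proof eventually_elim
      case (elim \<omega>)
      let ?y = "snd (\<omega> n)"
      have y: "?y \<in> states m" using elim by simp
      interpret tr: prob_space "transition m ?y (f ?y)" by (rule prob_transition[OF y])
      have ae: "AE w in shifted_transition (\<omega> n). u w = b * fst w + h (snd w)"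
        using AE_shifted_transition[OF y]
        by eventually_elim (use elim(1) in \<open>auto simp: u_def c_def algebra_simps\<close>)
      have "(\<integral>w. u w \<partial>shifted_transition (\<omega> n)) =
          (\<integral>w. b * fst w + h (snd w) \<partial>shifted_transition (\<omega> n))"
        by (intro integral_cong_AE ae) (auto simp: measurable_cong_sets[OF sets_shifted_transition refl])
      also have "\<dots> = (\<integral>z. b * fst (\<omega> n) + (b * fst z + h (snd z)) \<partial>transition m ?y (f ?y))"
        by (subst integral_shifted_transition[OF y]) (auto simp: algebra_simps)
      also have "\<dots> = b * fst (\<omega> n) + (\<integral>z. b * fst z + h (snd z) \<partial>transition m ?y (f ?y))"
        using integrable_transition[OF y h bound, where b = b] tr.prob_space by simp
      finally show ?case .
    qed
    show "(\<lambda>\<omega>. b * fst (\<omega> n) + (\<integral>z. b * fst z + h (snd z) \<partial>transition m (snd (\<omega> n)) (f (snd (\<omega> n))))) \<in> borel_measurable path"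
    proof -
      have [measurable]: "(\<lambda>z. b * fst z + h (snd z)) \<in> borel_measurable epochs"
        by measurable
      have "(\<lambda>y. \<integral>z. b * fst z + h (snd z) \<partial>transition m y (f y)) \<in> borel_measurable (state_space m)"
        by (rule measurable_compose[OF measurable_transition_policy integral_measurable_subprob_algebra]) measurable
      from measurable_compose[OF _ this] show ?thesis by measurable
    qed
  qed measurable
  finally show ?thesis .
qed

end

section \<open>Drift and average cost\<close>

lemma (in maintenance) measurable_cost:
  assumes f: "f \<in> policies m"
  shows "(\<lambda>y. cost m y (f y)) \<in> borel_measurable (state_space m)"
proof (rule measurable_compose_countable[where g = f])
  show "f \<in> state_space m \<rightarrow>\<^sub>M count_space UNIV"
    using f by (simp add: policies_def)
  show "(\<lambda>y. cost m y a) \<in> borel_measurable (state_space m)" for a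
    by (rule measurable_state_function) (cases a; simp)
qed

lemma abs_cost_le: "\<bar>cost m y a\<bar> \<le> \<bar>c_cm m\<bar> + \<bar>c_pm_so m\<bar> + \<bar>c_pm_uso m\<bar>"
  by (cases "(m, y, a)" rule: cost.cases) auto

lemma (in maintenance) integral_transition_renewal:
  fixes h :: "state \<Rightarrow> real" and v :: "cond \<Rightarrow> real \<Rightarrow> real"
  assumes meas: "\<And>k j. (\<lambda>t. h (k, j, t)) \<in> borel_measurable borel"
    and bound: "\<And>k j t. 0 \<le> t \<Longrightarrow> t \<le> tau m \<Longrightarrow> \<bar>h (k, j, t)\<bar> \<le> B"
    and deriv: "\<And>k t. 0 \<le> t \<Longrightarrow> t \<le> tau m \<Longrightarrow> (v k has_real_derivative
        mu m k * h (k, SC, t) + lam m * h (k, USO, t) - exit_rate k * v k t + b) (at t)"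
    and init: "\<And>k. v k 0 = h (k, SO, 0)"
    and y: "y \<in> states m"
  shows "(\<integral>z. b * fst z + h (snd z) \<partial>transition m y a) = (\<integral>k. v k (remaining m y) \<partial>cond_after m y a)"
proof -
  have "\<bar>h z\<bar> \<le> B" if "z \<in> states m" for z
    using bound that by (rule bound_on_states)
  from integral_transition[OF y measurable_state_function[OF meas] this]
  show ?thesis
    using integral_next_epoch[OF remaining[OF y] meas bound deriv init] by simp
qed

context controlled
begin

abbreviation mean_time :: "nat \<Rightarrow> real" where
  "mean_time n \<equiv> (\<integral>\<omega>. fst (\<omega> n) \<partial>path)"

text \<open>
  The inequality \<open>step\<close> makes \<open>b * T n + h (X n) + (\<Sum>k<n. \<psi> (X k))\<close> a submartingale, and only the resulting
  monotonicity of its expectation matters. Three instances are used: \<open>b = - g\<close> with the costs for \<open>\<psi>\<close>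
  bounds the cost of a policy from below, the negated instance from above, and \<open>b = 1\<close> with a negative
  constant for \<open>\<psi>\<close> bounds epoch times.
\<close>
lemma drift:
  fixes h \<psi> :: "state \<Rightarrow> real"
  assumes h [measurable]: "h \<in> borel_measurable (state_space m)"
    and hB: "\<And>y. y \<in> states m \<Longrightarrow> \<bar>h y\<bar> \<le> B"
    and \<psi> [measurable]: "\<psi> \<in> borel_measurable (state_space m)"
    and \<psi>B: "\<And>y. y \<in> states m \<Longrightarrow> \<bar>\<psi> y\<bar> \<le> B'"
    and step: "\<And>y. y \<in> states m \<Longrightarrow> h y \<le> \<psi> y + (\<integral>z. b * fst z + h (snd z) \<partial>transition m y (f y))"
  shows "h x \<le> b * mean_time n + (\<integral>\<omega>. h (snd (\<omega> n)) \<partial>path) + (\<integral>\<omega>. (\<Sum>k<n. \<psi> (snd (\<omega> k))) \<partial>path)"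
proof -
  define G where "G y = (\<integral>z. b * fst z + h (snd z) \<partial>transition m y (f y))" for y
  have G [measurable]: "G \<in> borel_measurable (state_space m)"
    unfolding G_def
    by (rule measurable_compose[OF measurable_transition_policy integral_measurable_subprob_algebra]) measurable
  have GB: "\<bar>G y\<bar> \<le> \<bar>b\<bar> * tau m + B" if y: "y \<in> states m" for y
  proof -
    interpret tr: prob_space "transition m y (f y)" by (rule prob_transition[OF y])
    have "AE z in transition m y (f y). \<bar>b * fst z + h (snd z)\<bar> \<le> \<bar>b\<bar> * tau m + B"
      using AE_transition[OF y] AE_space
    proof eventually_elim
      case (elim z)
      then have "snd z \<in> states m" by (auto simp: space_transition[OF y])
      moreover have "\<bar>b * fst z\<bar> \<le> \<bar>b\<bar> * tau m"
        using elim by (auto simp: abs_mult intro!: mult_left_mono)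
      ultimately show ?case
        by (intro order_trans[OF abs_triangle_ineq add_mono] hB)
    qed
    then have "(\<integral>z. \<bar>b * fst z + h (snd z)\<bar> \<partial>transition m y (f y)) \<le> \<bar>b\<bar> * tau m + B"
      using integrable_transition[OF y h hB, where b = b and a = "f y"] by (intro tr.integral_le_const) auto
    then show ?thesis
      unfolding G_def by (rule order_trans[OF integral_abs_bound])
  qed
  have int\<psi>: "integrable path (\<lambda>\<omega>. \<psi> (snd (\<omega> k)))" for k
    using integrable_path[OF \<psi> \<psi>B, of 0] by simp
  have inth: "integrable path (\<lambda>\<omega>. h (snd (\<omega> k)))" for k
    using integrable_path[OF h hB, of 0] by simp
  have intT: "integrable path (\<lambda>\<omega>. fst (\<omega> k))" for k
    using integrable_path[of "\<lambda>_. 0" 0 1] by simp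
  have "h x \<le> (\<integral>\<omega>. b * fst (\<omega> n) + h (snd (\<omega> n)) \<partial>path) + (\<Sum>k<n. \<integral>\<omega>. \<psi> (snd (\<omega> k)) \<partial>path)"
  proof (induction n)
    case 0
    have "(\<integral>\<omega>. b * fst (\<omega> 0) + h (snd (\<omega> 0)) \<partial>path) =
        (\<integral>w. b * fst w + h (snd w) \<partial>distr path epochs (\<lambda>\<omega>. \<omega> 0))"
      by (subst integral_distr) auto
    also have "\<dots> = h x"
      using start unfolding distr_path_0 by (subst integral_return) (auto simp: space_pair_measure)
    finally show ?case by simp
  next
    case (Suc n)
    have "(\<integral>\<omega>. b * fst (\<omega> n) + h (snd (\<omega> n)) \<partial>path) - (\<integral>\<omega>. \<psi> (snd (\<omega> n)) \<partial>path)
        = (\<integral>\<omega>. b * fst (\<omega> n) + h (snd (\<omega> n)) - \<psi> (snd (\<omega> n)) \<partial>path)"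
      using integrable_path[OF h hB, of b n] int\<psi> by simp
    also have "\<dots> \<le> (\<integral>\<omega>. b * fst (\<omega> n) + G (snd (\<omega> n)) \<partial>path)"
    proof (rule integral_mono_AE)
      show "AE \<omega> in path. b * fst (\<omega> n) + h (snd (\<omega> n)) - \<psi> (snd (\<omega> n)) \<le> b * fst (\<omega> n) + G (snd (\<omega> n))"
        using AE_path_states
      proof eventually_elim
        case (elim \<omega>)
        then show ?case using step[of "snd (\<omega> n)"] by (simp add: G_def)
      qed
    qed (use integrable_path[OF h hB, of b n] int\<psi> integrable_path[OF G GB, of b n] in simp_all)
    also have "\<dots> = (\<integral>\<omega>. b * fst (\<omega> (Suc n)) + h (snd (\<omega> (Suc n))) \<partial>path)"
      unfolding G_def by (rule integral_path_Suc[OF h hB, symmetric])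
    finally show ?case using Suc.IH by simp
  qed
  then show ?thesis
    using inth intT int\<psi> by simp
qed

text \<open>
  A sojourn can be arbitrarily short in expectation, namely just before a scheduled opportunity. But then
  that opportunity is likely to be the next epoch, and the sojourn after it is long. The
  function \<open>h\<close>, a bonus \<open>K\<close> at scheduled opportunities, credits this in advance; \<open>K\<close> is at most half of each
  mean waiting time \<open>1 / exit_rate k\<close>, so that the bonus is repaid with a margin at the next sojourn.
\<close>
lemma mean_time_growth: "\<exists>\<delta>>0. \<exists>K. \<forall>n. \<delta> * real n - K \<le> mean_time n"
proof -
  define K where "K = 1 / (2 * (lam m + mu m Satisfactory + mu m Perfect))"
  define \<delta> where "\<delta> = K * (1 - exp (- lam m * tau m))"
  have K: "0 < K" "2 * K \<le> 1 / exit_rate k" for k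
  proof -
    have pos: "0 < lam m" "0 < mu m Satisfactory" "0 < mu m Perfect"
      using lam_pos mu_pos by auto
    then show "0 < K" by (simp add: K_def)
    have "exit_rate k \<le> lam m + mu m Satisfactory + mu m Perfect"
      using pos by (cases k) auto
    then have "1 / (lam m + mu m Satisfactory + mu m Perfect) \<le> 1 / exit_rate k"
      using exit_rate_pos[of k] by (intro divide_left_mono) auto
    moreover have "2 * K = 1 / (lam m + mu m Satisfactory + mu m Perfect)"
      using pos by (simp add: K_def field_simps)
    ultimately show "2 * K \<le> 1 / exit_rate k" by simp
  qed
  have \<delta>: "0 < \<delta>" "\<delta> \<le> K"
    using K lam_pos tau_pos by (auto simp: \<delta>_def mult_le_cancel_left2)
  define h :: "state \<Rightarrow> real" where "h y = (if fst (snd y) = SO then K else 0)" for y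
  \<comment> \<open>The solution of \<open>v' = 1 - exit_rate k * v\<close> with \<open>v 0 = K\<close>.\<close>
  define v where "v k r = 1 / exit_rate k + exp (- exit_rate k * r) * (K - 1 / exit_rate k)" for k r
  have step: "h y \<le> - \<delta> + (\<integral>z. 1 * fst z + h (snd z) \<partial>transition m y (f y))" if y: "y \<in> states m" for y
  proof -
    have "(\<integral>z. 1 * fst z + h (snd z) \<partial>transition m y (f y)) = (\<integral>k. v k (remaining m y) \<partial>cond_after m y (f y))"
    proof (rule integral_transition_renewal[OF _ _ _ _ y, where B = K])
      show "(v k has_real_derivative mu m k * h (k, SC, t) + lam m * h (k, USO, t) - exit_rate k * v k t + 1) (at t)"
        for k t
      proof -
        have "((\<lambda>r. 1 / b + exp (- b * r) * (K - 1 / b)) has_real_derivative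
            1 - b * (1 / b + exp (- b * t) * (K - 1 / b))) (at t)" if "0 < b" for b :: real
          using that by (auto intro!: derivative_eq_intros simp: distrib_left mult.assoc)
        from this[OF exit_rate_pos[of k]] show ?thesis by (simp add: v_def[abs_def] h_def)
      qed
    qed (use K in \<open>auto simp: h_def v_def\<close>)
    moreover have "h y + \<delta> \<le> v k (remaining m y)" for k
    proof (cases "fst (snd y) = SO")
      case True
      then have r: "remaining m y = tau m" by (cases y) auto
      have "K * (1 - exp (- lam m * tau m)) \<le> (1 / exit_rate k - K) * (1 - exp (- exit_rate k * tau m))"
        using K(1) K(2)[of k] mu_pos[of k] lam_pos tau_pos
        by (intro mult_mono) (auto simp: algebra_simps)
      then show ?thesis using True r by (simp add: h_def v_def \<delta>_def algebra_simps)
    next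
      case False
      have e: "exp (- exit_rate k * remaining m y) \<le> 1" (is "?e \<le> 1")
        using mu_pos[of k] lam_pos remaining[OF y] by (simp add: mult_nonpos_nonneg)
      have "K \<le> K + (1 - ?e) * (1 / exit_rate k - K)"
        using K(1) K(2)[of k] e by simp
      also have "\<dots> = v k (remaining m y)" by (simp add: v_def algebra_simps)
      finally show ?thesis using False \<delta> by (simp add: h_def)
    qed
    ultimately show ?thesis
      using measure_pmf.integral_ge_const[of "cond_after m y (f y)" "\<lambda>k. v k (remaining m y)" "h y + \<delta>"]
      by (simp add: integrable_measure_pmf_finite)
  qed
  have hm: "h \<in> borel_measurable (state_space m)"
    by (rule measurable_state_function) (simp add: h_def)
  have inth: "integrable path (\<lambda>\<omega>. h (snd (\<omega> n)))" for n
    using integrable_path[OF hm, of K 0 n] K by (simp add: h_def)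
  have "\<delta> * real n - K \<le> mean_time n" for n
  proof -
    have "h x \<le> 1 * mean_time n + (\<integral>\<omega>. h (snd (\<omega> n)) \<partial>path) + (\<integral>\<omega>. (\<Sum>k<n. - \<delta>) \<partial>path)"
      by (rule drift[where \<psi> = "\<lambda>_. - \<delta>" and B' = \<delta> and B = K, OF hm _ _ _ step]) (use K \<delta> in \<open>auto simp: h_def\<close>)
    moreover have "(\<integral>\<omega>. h (snd (\<omega> n)) \<partial>path) \<le> K"
      using inth K by (intro path.integral_le_const) (auto simp: h_def)
    moreover have "0 \<le> h x" using K by (simp add: h_def)
    ultimately show ?thesis by (simp add: path.prob_space mult.commute)
  qed
  with \<delta> show ?thesis by blast
qed

lemma mean_time_at_top: "filterlim mean_time at_top sequentially"
proof -
  obtain \<delta> K where \<delta>: "0 < \<delta>" and le: "\<And>n. \<delta> * real n - K \<le> mean_time n"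
    using mean_time_growth by blast
  have "filterlim (\<lambda>n. \<delta> * real n) at_top sequentially"
    using \<delta> by (intro filterlim_tendsto_pos_mult_at_top[OF tendsto_const _ filterlim_real_sequentially])
  then have "filterlim (\<lambda>n. - K + \<delta> * real n) at_top sequentially"
    by (rule filterlim_tendsto_add_at_top[OF tendsto_const])
  then show ?thesis
    by (rule filterlim_at_top_mono) (use le in \<open>auto simp: algebra_simps\<close>)
qed

abbreviation mean_cost :: "nat \<Rightarrow> real" where
  "mean_cost n \<equiv> (\<integral>\<omega>. (\<Sum>k<n. cost m (snd (\<omega> k)) (f (snd (\<omega> k)))) \<partial>path)"

lemma average_cost_eq: "average_cost m x f = limsup (\<lambda>n. ereal (mean_cost n / mean_time n))"
  by (simp add: average_cost_def epoch_state_def epoch_time_def)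

lemma mean_cost_ge:
  assumes h: "h \<in> borel_measurable (state_space m)"
    and hB: "\<And>y. y \<in> states m \<Longrightarrow> \<bar>h y\<bar> \<le> B"
    and step: "\<And>y. y \<in> states m \<Longrightarrow>
      h y \<le> cost m y (f y) + (\<integral>z. (- g) * fst z + h (snd z) \<partial>transition m y (f y))"
  shows "g * mean_time n - 2 * B \<le> mean_cost n"
proof -
  have "h x \<le> (- g) * mean_time n + (\<integral>\<omega>. h (snd (\<omega> n)) \<partial>path) + mean_cost n"
    by (rule drift[OF h hB measurable_cost[OF policy] abs_cost_le step])
  moreover have "(\<integral>\<omega>. h (snd (\<omega> n)) \<partial>path) \<le> B"
  proof (rule path.integral_le_const)
    show "AE \<omega> in path. h (snd (\<omega> n)) \<le> B"
      using AE_path_states by eventually_elim (use hB in \<open>auto simp: abs_le_iff\<close>)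
    show "integrable path (\<lambda>\<omega>. h (snd (\<omega> n)))"
      using integrable_path[OF h hB, of 0] by simp
  qed
  moreover have "- B \<le> h x" using hB[OF start] by (simp add: abs_le_iff)
  ultimately show ?thesis by simp
qed

lemma mean_cost_le:
  assumes h: "h \<in> borel_measurable (state_space m)"
    and hB: "\<And>y. y \<in> states m \<Longrightarrow> \<bar>h y\<bar> \<le> B"
    and step: "\<And>y. y \<in> states m \<Longrightarrow>
      cost m y (f y) + (\<integral>z. (- g) * fst z + h (snd z) \<partial>transition m y (f y)) \<le> h y"
  shows "mean_cost n \<le> g * mean_time n + 2 * B"
proof -
  have "- h x \<le> g * mean_time n + (\<integral>\<omega>. - h (snd (\<omega> n)) \<partial>path)
      + (\<integral>\<omega>. (\<Sum>k<n. - cost m (snd (\<omega> k)) (f (snd (\<omega> k)))) \<partial>path)"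
  proof (rule drift)
    show "- h y \<le> - cost m y (f y) + (\<integral>z. g * fst z + - h (snd z) \<partial>transition m y (f y))"
      if "y \<in> states m" for y
    proof -
      have "(\<integral>z. g * fst z + - h (snd z) \<partial>transition m y (f y)) =
          - (\<integral>z. (- g) * fst z + h (snd z) \<partial>transition m y (f y))"
        unfolding integral_minus[symmetric] by simp
      with step[OF that] show ?thesis by linarith
    qed
  qed (use h hB abs_cost_le measurable_cost[OF policy] in auto)
  moreover have "- B \<le> (\<integral>\<omega>. h (snd (\<omega> n)) \<partial>path)"
  proof (rule path.integral_ge_const)
    show "AE \<omega> in path. - B \<le> h (snd (\<omega> n))"
      using AE_path_states
    proof eventually_elim
      case (elim \<omega>)
      then show ?case using hB[of "snd (\<omega> n)"] by (simp add: abs_le_iff)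
    qed
    show "integrable path (\<lambda>\<omega>. h (snd (\<omega> n)))"
      using integrable_path[OF h hB, of 0] by simp
  qed
  moreover have "h x \<le> B" using hB[OF start] by (simp add: abs_le_iff)
  ultimately show ?thesis by (simp add: sum_negf)
qed

lemma average_cost_ge:
  assumes "\<And>n. g * mean_time n - K \<le> mean_cost n"
  shows "ereal g \<le> average_cost m x f"
proof -
  have "(\<lambda>n. g - K / mean_time n) \<longlonglongrightarrow> g - 0"
    by (intro tendsto_diff tendsto_const tendsto_divide_0[OF tendsto_const]
        filterlim_at_top_imp_at_infinity mean_time_at_top)
  then have "ereal g = limsup (\<lambda>n. ereal (g - K / mean_time n))"
    by (intro lim_imp_Limsup[symmetric]) auto
  also have "\<dots> \<le> average_cost m x f"
    unfolding average_cost_eq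
  proof (rule Limsup_mono)
    have "eventually (\<lambda>n. 0 < mean_time n) sequentially"
      using mean_time_at_top by (auto simp: filterlim_at_top_dense)
    then show "eventually (\<lambda>n. ereal (g - K / mean_time n) \<le> ereal (mean_cost n / mean_time n)) sequentially"
    proof eventually_elim
      case (elim n)
      then have "g - K / mean_time n = (g * mean_time n - K) / mean_time n"
        by (simp add: field_simps)
      also have "\<dots> \<le> mean_cost n / mean_time n"
        using elim assms by (intro divide_right_mono) auto
      finally show ?case by simp
    qed
  qed
  finally show ?thesis .
qed

lemma average_cost_le:
  assumes "\<And>n. mean_cost n \<le> g * mean_time n + K"
  shows "average_cost m x f \<le> ereal g"
proof -
  have "(\<lambda>n. g + K / mean_time n) \<longlonglongrightarrow> g + 0"
    by (intro tendsto_add tendsto_const tendsto_divide_0[OF tendsto_const]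
        filterlim_at_top_imp_at_infinity mean_time_at_top)
  then have "limsup (\<lambda>n. ereal (g + K / mean_time n)) = ereal g"
    by (intro lim_imp_Limsup) auto
  moreover have "average_cost m x f \<le> limsup (\<lambda>n. ereal (g + K / mean_time n))"
    unfolding average_cost_eq
  proof (rule Limsup_mono)
    have "eventually (\<lambda>n. 0 < mean_time n) sequentially"
      using mean_time_at_top by (auto simp: filterlim_at_top_dense)
    then show "eventually (\<lambda>n. ereal (mean_cost n / mean_time n) \<le> ereal (g + K / mean_time n)) sequentially"
    proof eventually_elim
      case (elim n)
      have "mean_cost n / mean_time n \<le> (g * mean_time n + K) / mean_time n"
        using elim assms by (intro divide_right_mono) auto
      also have "\<dots> = g + K / mean_time n"
        using elim by (simp add: field_simps)
      finally show ?case by simp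
    qed
  qed
  ultimately show ?thesis by simp
qed

end

text \<open>
  The verification theorem of average cost dynamic programming, with \<open>g\<close> as optimal cost rate and \<open>h\<close> as
  relative value function. Boundedness of \<open>h\<close> makes its contribution vanish after division by the
  expected time.
\<close>
lemma (in maintenance) optimal_policy_if_optimality_equation:
  assumes h: "h \<in> borel_measurable (state_space m)"
    and hB: "\<And>y. y \<in> states m \<Longrightarrow> \<bar>h y\<bar> \<le> B"
    and ineq: "\<And>y a. y \<in> states m \<Longrightarrow> a \<in> admissible y \<Longrightarrow>
      h y \<le> cost m y a + (\<integral>z. (- g) * fst z + h (snd z) \<partial>transition m y a)"
    and f: "f \<in> policies m"
    and eq: "\<And>y. y \<in> states m \<Longrightarrow>
      h y = cost m y (f y) + (\<integral>z. (- g) * fst z + h (snd z) \<partial>transition m y (f y))"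
  shows "optimal_policy m f"
proof -
  have lower: "ereal g \<le> average_cost m x p" if "x \<in> states m" "p \<in> policies m" for x p
  proof -
    interpret controlled m p x using that by unfold_locales
    show ?thesis
    proof (rule average_cost_ge[OF mean_cost_ge[OF h hB]])
      fix y assume y: "y \<in> states m"
      then have "p y \<in> admissible y" using that by (auto simp: policies_def)
      with y show "h y \<le> cost m y (p y) + (\<integral>z. (- g) * fst z + h (snd z) \<partial>transition m y (p y))"
        by (rule ineq)
    qed
  qed
  have upper: "average_cost m x f \<le> ereal g" if "x \<in> states m" for x
  proof -
    interpret controlled m f x using that f by unfold_locales
    show ?thesis
      using eq by (intro average_cost_le[OF mean_cost_le[OF h hB]]) simp_all
  qed
  show ?thesis
    unfolding optimal_policy_def
  proof (intro conjI ballI f antisym)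
    fix x assume x: "x \<in> states m"
    show "average_cost m x f \<le> (INF p\<in>policies m. average_cost m x p)"
      using upper[OF x] lower[OF x] by (intro INF_greatest) (blast intro: order_trans)
    show "(INF p\<in>policies m. average_cost m x p) \<le> average_cost m x f"
      using f by (rule INF_lower)
  qed
qed

section \<open>Solving the optimality equation\<close>

context maintenance
begin

text \<open>
  Here \<open>w\<close> is the relative value in the perfect condition and \<open>D\<close> the excess value in the satisfactory
  one, both as functions of the time until the next scheduled opportunity.
\<close>
fun value_after :: "(real \<Rightarrow> real) \<Rightarrow> (real \<Rightarrow> real) \<Rightarrow> cond \<Rightarrow> real \<Rightarrow> real" where
  "value_after w D Perfect t = w t"
| "value_after w D Satisfactory t = w t + D t"

text \<open>
  The value at the moment of an epoch, before the action. At an unscheduled opportunity the minimum of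
  both actions is built in; at a scheduled one it enters through \<open>D_jump\<close> in the next lemma.
\<close>
fun relative_value :: "(real \<Rightarrow> real) \<Rightarrow> (real \<Rightarrow> real) \<Rightarrow> state \<Rightarrow> real" where
  "relative_value w D (Perfect, SC, t) = w t + D t"
| "relative_value w D (Satisfactory, SC, t) = c_cm m + w t"
| "relative_value w D (Perfect, USO, t) = w t"
| "relative_value w D (Satisfactory, USO, t) = w t + D t + min 0 (c_pm_uso m - prob_new m * D t)"
| "relative_value w D (k, SO, t) = value_after w D k 0"

text \<open>
  By \<open>integral_transition_renewal\<close> the two differential equations say that \<open>value_after\<close> is the expected
  relative value at the next epoch minus \<open>g\<close> times the expected sojourn, so that the optimality equation
  becomes a comparison of two numbers in each state.
\<close>
lemma optimal_policy_if_ode: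
  fixes w D :: "real \<Rightarrow> real" and g :: real
  assumes cont: "continuous_on UNIV w" "continuous_on UNIV D"
    and w: "\<And>t. 0 \<le> t \<Longrightarrow> t \<le> tau m \<Longrightarrow>
      (w has_real_derivative mu m Perfect * D t - g) (at t)"
    and D: "\<And>t. 0 \<le> t \<Longrightarrow> t \<le> tau m \<Longrightarrow> (D has_real_derivative
      mu m Satisfactory * c_cm m - (mu m Satisfactory + mu m Perfect) * D t
        + lam m * min 0 (c_pm_uso m - prob_new m * D t)) (at t)"
    and w_periodic: "w (tau m) = w 0"
    and D_jump: "D 0 = D (tau m) + min 0 (c_pm_so m - prob_new m * D (tau m))"
    and costs: "0 \<le> c_pm_uso m" "0 \<le> c_pm_so m"
    and f: "f \<in> policies m"
    and f_perfect: "\<And>j t. f (Perfect, j, t) = Do_Nothing"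
    and f_uso: "\<And>t. 0 < t \<Longrightarrow> t < tau m \<Longrightarrow>
      if f (Satisfactory, USO, t) = Perform_PM then c_pm_uso m \<le> prob_new m * D t
      else prob_new m * D t \<le> c_pm_uso m"
    and f_so: "if f (Satisfactory, SO, 0) = Perform_PM then c_pm_so m \<le> prob_new m * D (tau m)
      else prob_new m * D (tau m) \<le> c_pm_so m"
  shows "optimal_policy m f"
proof -
  let ?h = "relative_value w D" and ?v = "value_after w D" and ?p = "prob_new m"
  have [measurable]: "w \<in> borel_measurable borel" "D \<in> borel_measurable borel"
    using cont by (auto intro: borel_measurable_continuous_onI)
  have meas: "(\<lambda>t. ?h (k, j, t)) \<in> borel_measurable borel" for k j
    by (cases k; cases j) simp_all
  obtain B where B: "\<bar>?h (k, j, t)\<bar> \<le> B" if "0 \<le> t" "t \<le> tau m" for k j t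
  proof -
    have "compact (w ` {0..tau m})" "compact (D ` {0..tau m})"
      using cont by (auto intro!: compact_continuous_image intro: continuous_on_subset)
    then obtain W E where "\<forall>y\<in>w ` {0..tau m}. norm y \<le> W" "\<forall>y\<in>D ` {0..tau m}. norm y \<le> E"
      unfolding bounded_iff[symmetric] using compact_imp_bounded by (meson bounded_iff)
    then have W: "\<bar>w t\<bar> \<le> W" and E: "\<bar>D t\<bar> \<le> E" if "0 \<le> t" "t \<le> tau m" for t
      using that by auto
    have "\<bar>?h (k, j, t)\<bar> \<le> W + (E + (\<bar>c_cm m\<bar> + (\<bar>c_pm_uso m\<bar> + E)))" if t: "0 \<le> t" "t \<le> tau m" for k j t
    proof -
      have "\<bar>?p * D t\<bar> \<le> 1 * E"
        unfolding abs_mult using E[OF t] prob_new by (intro mult_mono) auto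
      then show ?thesis
        using W[OF t] E[OF t] W[of 0] E[of 0] tau_pos by (cases k; cases j) auto
    qed
    then show ?thesis by (rule that)
  qed
  have dv: "(?v k has_real_derivative
      mu m k * ?h (k, SC, t) + lam m * ?h (k, USO, t) - exit_rate k * ?v k t + (- g)) (at t)"
    if t: "0 \<le> t" "t \<le> tau m" for k t
  proof (cases k)
    case Perfect
    have "?v Perfect = w" by (simp add: fun_eq_iff)
    with w[OF t] Perfect show ?thesis by (simp add: algebra_simps)
  next
    case Satisfactory
    have "?v Satisfactory = (\<lambda>t. w t + D t)" by (simp add: fun_eq_iff)
    with DERIV_add[OF w[OF t] D[OF t]] Satisfactory show ?thesis by (simp add: algebra_simps)
  qed
  have step: "(\<integral>z. (- g) * fst z + ?h (snd z) \<partial>transition m y a) =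
      (\<integral>k. ?v k (remaining m y) \<partial>cond_after m y a)" if "y \<in> states m" for y a
    using B dv that by (intro integral_transition_renewal[OF meas]) auto
  have hB: "\<bar>?h y\<bar> \<le> B" if "y \<in> states m" for y
    using B that by (rule bound_on_states)
  \<comment> \<open>The right-hand side of the optimality equation.\<close>
  define Q where "Q y a = cost m y a + (\<integral>k. ?v k (remaining m y) \<partial>cond_after m y a)" for y a
  have Q: "Q (Perfect, SC, t) Do_Nothing = ?h (Perfect, SC, t)"
    "Q (Satisfactory, SC, t) Perform_CM = ?h (Satisfactory, SC, t)"
    "Q (Perfect, USO, t) Do_Nothing = ?h (Perfect, USO, t)"
    "Q (Perfect, USO, t) Perform_PM = ?h (Perfect, USO, t) + c_pm_uso m"
    "Q (Perfect, SO, t) Do_Nothing = ?h (Perfect, SO, t)"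
    "Q (Perfect, SO, t) Perform_PM = ?h (Perfect, SO, t) + c_pm_so m"
    "Q (Satisfactory, USO, t) Do_Nothing = w t + D t"
    "Q (Satisfactory, USO, t) Perform_PM = w t + D t + (c_pm_uso m - ?p * D t)"
    "Q (Satisfactory, SO, t) Do_Nothing = w 0 + D (tau m)"
    "Q (Satisfactory, SO, t) Perform_PM = w 0 + D (tau m) + (c_pm_so m - ?p * D (tau m))" for t
    using prob_new w_periodic by (simp_all add: Q_def algebra_simps)
  have h_so: "?h (Satisfactory, SO, t) = w 0 + D (tau m) + min 0 (c_pm_so m - ?p * D (tau m))" for t
    using D_jump by simp
  show ?thesis
  proof (rule optimal_policy_if_optimality_equation[OF measurable_state_function[OF meas] hB _ f])
    fix y a assume y: "y \<in> states m"
    obtain k j t where z: "y = (k, j, t)" by (metis prod.collapse)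
    {
      assume "a \<in> admissible y"
      then have "?h y \<le> Q y a"
        unfolding z using costs by (cases k; cases j) (auto simp: Q h_so simp del: relative_value.simps(5))
      then show "?h y \<le> cost m y a + (\<integral>z. (- g) * fst z + ?h (snd z) \<partial>transition m y a)"
        using step[OF y] by (simp add: Q_def)
    }
    have adm: "f y \<in> admissible y" using f y by (auto simp: policies_def)
    have "?h y = Q y (f y)"
    proof (cases k)
      case Perfect
      then show ?thesis using f_perfect[of j t] by (cases j) (simp_all add: z Q)
    next
      case Satisfactory
      show ?thesis
      proof (cases j)
        case SC
        then show ?thesis using adm Satisfactory by (simp add: z Q)
      next
        case USO
        then show ?thesis using adm Satisfactory f_uso[of t] y by (auto simp: z Q states_iff split: if_splits)
      next
        case SO
        then show ?thesis using adm Satisfactory f_so y 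
          by (auto simp: z Q h_so states_iff split: if_splits simp del: relative_value.simps(5))
      qed
    qed
    then show "?h y = cost m y (f y) + (\<integral>z. (- g) * fst z + ?h (snd z) \<partial>transition m y (f y))"
      using step[OF y] by (simp add: Q_def)
  qed
qed

text \<open>
  Given \<open>D\<close>, the value \<open>w\<close> is found by integration, and \<open>g\<close> is the cost rate that makes \<open>w\<close> periodic:
  \<open>mu m Perfect\<close> times the mean of \<open>D\<close> over a period. Thus everything reduces to \<open>D\<close>, and the
  solutions that occur approach an equilibrium \<open>d\<close> exponentially.
\<close>
lemma optimal_policy_if_exponential:
  fixes d e \<gamma> :: real
  defines "D \<equiv> \<lambda>t. d + e * exp (- \<gamma> * t)"
  assumes \<gamma>: "0 < \<gamma>"
    and D: "\<And>t. 0 \<le> t \<Longrightarrow> t \<le> tau m \<Longrightarrow> \<gamma> * (d - D t) =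
      mu m Satisfactory * c_cm m - (mu m Satisfactory + mu m Perfect) * D t
        + lam m * min 0 (c_pm_uso m - prob_new m * D t)"
    and D_jump: "D 0 = D (tau m) + min 0 (c_pm_so m - prob_new m * D (tau m))"
    and costs: "0 \<le> c_pm_uso m" "0 \<le> c_pm_so m"
    and f: "f \<in> policies m"
    and f_perfect: "\<And>j t. f (Perfect, j, t) = Do_Nothing"
    and f_uso: "\<And>t. 0 < t \<Longrightarrow> t < tau m \<Longrightarrow>
      if f (Satisfactory, USO, t) = Perform_PM then c_pm_uso m \<le> prob_new m * D t
      else prob_new m * D t \<le> c_pm_uso m"
    and f_so: "if f (Satisfactory, SO, 0) = Perform_PM then c_pm_so m \<le> prob_new m * D (tau m)
      else prob_new m * D (tau m) \<le> c_pm_so m"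
  shows "optimal_policy m f"
proof -
  define I where "I t = d * t + e * ((1 - exp (- \<gamma> * t)) / \<gamma>)" for t
  have dI: "(I has_real_derivative D t) (at t)" for t
    unfolding I_def D_def using \<gamma> by (auto intro!: derivative_eq_intros)
  define g where "g = mu m Perfect * I (tau m) / tau m"
  define w where "w t = mu m Perfect * I t - g * t" for t
  have dw: "(w has_real_derivative mu m Perfect * D t - g) (at t)" for t
    unfolding w_def by (auto intro!: derivative_eq_intros dI)
  have dD: "(D has_real_derivative \<gamma> * (d - D t)) (at t)" for t
    unfolding D_def by (auto intro!: derivative_eq_intros)
  show ?thesis
  proof (rule optimal_policy_if_ode[OF _ _ dw _ _ D_jump costs f f_perfect f_uso f_so])
    show "continuous_on UNIV w" "continuous_on UNIV D"
      using dw dD DERIV_isCont by (blast intro: continuous_at_imp_continuous_on)+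
    show "w (tau m) = w 0"
      using tau_pos by (simp add: w_def g_def I_def)
    show "(D has_real_derivative mu m Satisfactory * c_cm m
        - (mu m Satisfactory + mu m Perfect) * D t
        + lam m * min 0 (c_pm_uso m - prob_new m * D t)) (at t)"
      if "0 \<le> t" "t \<le> tau m" for t
      using dD[of t] D[OF that] by simp
  qed
qed

end

theorem theorem2:
  fixes m :: model
  assumes "mu m Satisfactory > 0" and "mu m Perfect > 0" and "lam m > 0" and "tau m > 0"
    and "0 < c_pm_uso m" and "c_pm_uso m < c_pm_so m" and "c_pm_so m < c_cm m"
    and "0 < prob_new m" and "prob_new m < 1"
  shows "optimal_policy m (\<lambda>(i, j, t). case i of
      Perfect \<Rightarrow> Do_Nothing
    | Satisfactory \<Rightarrow>
       (case j of
          SC \<Rightarrow> Perform_CM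
        | USO \<Rightarrow>
            if mu m Satisfactory * c_cm m
                 > (mu m Satisfactory + mu m Perfect) * (c_pm_uso m / prob_new m)
            then Perform_PM else Do_Nothing
        | SO \<Rightarrow>
            if mu m Satisfactory * c_cm m
                 > (mu m Satisfactory + mu m Perfect) * (c_pm_so m / prob_new m)
                   + lam m * (c_pm_so m - c_pm_uso m)
            then Perform_PM else Do_Nothing))" (is "optimal_policy m ?f")
proof -
  interpret maintenance m
  proof
    show "0 < mu m k" for k using assms by (cases k) auto
  qed (use assms in auto)
  define \<kappa> M p u s l where
    "\<kappa> = mu m Satisfactory * c_cm m" and "M = mu m Satisfactory + mu m Perfect" and
    "p = prob_new m" and "u = c_pm_uso m" and "s = c_pm_so m" and "l = lam m"
  note params = \<kappa>_def M_def p_def u_def s_def l_def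
  have pos: "0 < M" "0 < p" "p < 1" "0 < u" "u < s" "0 < l"
    using assms by (auto simp: params)
  have policy: "?f \<in> policies m"
  proof -
    have "?f = (\<lambda>x. ?f (fst x, fst (snd x), 0))"
    proof
      fix x :: state
      obtain i j t where "x = (i, j, t)" by (metis prod.collapse)
      then show "?f x = ?f (fst x, fst (snd x), 0)" by (cases i; cases j) simp_all
    qed
    moreover have "(\<lambda>x. ?f (fst x, fst (snd x), 0)) \<in> state_space m \<rightarrow>\<^sub>M count_space UNIV"
    proof (rule measurable_compose_countable[where g = fst])
      fix k
      show "(\<lambda>x. ?f (k, fst (snd x), 0)) \<in> state_space m \<rightarrow>\<^sub>M count_space UNIV"
        by (rule measurable_compose_countable[where g = "\<lambda>x. fst (snd x)"]) simp_all
    qed simp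
    ultimately have "?f \<in> state_space m \<rightarrow>\<^sub>M count_space UNIV" by simp
    moreover have "?f y \<in> admissible y" for y
      by (cases y rule: admissible.cases) (auto split: cond.split)
    ultimately show ?thesis by (simp add: policies_def)
  qed
  define pm_uso where "pm_uso \<longleftrightarrow> \<kappa> > M * (u / p)"
  define pm_so where "pm_so \<longleftrightarrow> \<kappa> > M * (s / p) + l * (s - u)"
  have f_uso: "?f (Satisfactory, USO, t) = (if pm_uso then Perform_PM else Do_Nothing)" for t
    by (simp add: pm_uso_def params)
  have f_so: "?f (Satisfactory, SO, t) = (if pm_so then Perform_PM else Do_Nothing)" for t
    by (simp add: pm_so_def params)
  \<comment> \<open>Unscheduled opportunities are cheaper, so maintenance pays there if it pays at scheduled ones.\<close>
  have so_imp_uso: pm_uso if pm_so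
  proof -
    have "M * (u / p) \<le> M * (s / p)"
      using pos by (intro mult_left_mono divide_right_mono) auto
    moreover have "0 \<le> l * (s - u)" using pos by simp
    ultimately show ?thesis using that by (simp add: pm_uso_def pm_so_def)
  qed
  \<comment> \<open>What remains to be checked for \<open>D t = d + e * exp (- \<gamma> * t)\<close>: the differential equation, the condition
    at scheduled opportunities, and that the decisions agree with \<open>D\<close>.\<close>
  define fits where "fits d e \<gamma> \<longleftrightarrow>
    (\<forall>t. 0 \<le> t \<longrightarrow> t \<le> tau m \<longrightarrow> \<gamma> * (d - (d + e * exp (- \<gamma> * t))) =
        \<kappa> - M * (d + e * exp (- \<gamma> * t)) + l * min 0 (u - p * (d + e * exp (- \<gamma> * t))) \<and>
      (if pm_uso then u \<le> p * (d + e * exp (- \<gamma> * t)) else p * (d + e * exp (- \<gamma> * t)) \<le> u)) \<and>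
    d + e = d + e * exp (- \<gamma> * tau m) + min 0 (s - p * (d + e * exp (- \<gamma> * tau m))) \<and>
    (if pm_so then s \<le> p * (d + e * exp (- \<gamma> * tau m)) else p * (d + e * exp (- \<gamma> * tau m)) \<le> s)" for d e \<gamma>
  have optimal: "optimal_policy m ?f" if o: "fits d e \<gamma>" and \<gamma>: "0 < \<gamma>" for d e \<gamma>
  proof (rule optimal_policy_if_exponential[OF \<gamma>, where d = d and e = e])
  qed (use o pos policy f_uso f_so in \<open>auto simp: fits_def params split: if_splits\<close>)
  \<comment> \<open>The rate of return to equilibrium when unscheduled opportunities are used.\<close>
  define \<gamma> where "\<gamma> = M + l * p"
  have \<gamma>: "0 < \<gamma>" using pos by (simp add: \<gamma>_def add_pos_nonneg)
  consider "\<not> pm_uso" | "pm_uso" "\<not> pm_so" | "pm_so" by blast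
  then show ?thesis
  proof cases
    case 1
    have le: "p * (\<kappa> / M) \<le> u"
      using 1 pos by (simp add: pm_uso_def field_simps)
    have "fits (\<kappa> / M) 0 M"
      using 1 so_imp_uso le pos by (auto simp: fits_def)
    then show ?thesis using pos(1) by (rule optimal)
  next
    case 2
    define d where "d = (\<kappa> + l * u) / \<gamma>"
    have "\<gamma> * d = \<kappa> + l * u" using \<gamma> by (simp add: d_def)
    moreover have "u \<le> p * d" "p * d \<le> s"
      using 2 pos \<gamma> by (simp_all add: pm_uso_def pm_so_def d_def \<gamma>_def field_simps)
    ultimately have "fits d 0 \<gamma>"
      using 2 pos by (auto simp: fits_def \<gamma>_def algebra_simps)
    then show ?thesis using \<gamma> by (rule optimal)
  next
    case 3
    define d where "d = (\<kappa> + l * u) / \<gamma>"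
    have \<gamma>d: "\<gamma> * d = \<kappa> + l * u" using \<gamma> by (simp add: d_def)
    have sd: "s < p * d"
      using 3 pos \<gamma> by (simp add: pm_so_def d_def \<gamma>_def field_simps)
    define E where "E = exp (- \<gamma> * tau m)"
    have E: "0 < E" "E < 1" using \<gamma> assms by (simp_all add: E_def)
    have qE: "0 < 1 - (1 - p) * E"
      using pos E mult_strict_mono[of "1 - p" 1 E 1] by simp
    \<comment> \<open>The solution of the linear equation \<open>D 0 = s + (1 - p) * D (tau m)\<close>.\<close>
    define e where "e = - (p * d - s) / (1 - (1 - p) * E)"
    have eq: "e * (1 - (1 - p) * E) = s - p * d" using qE by (simp add: e_def)
    have e: "e < 0" using qE sd by (simp add: e_def divide_neg_pos)
    have "p * (d + e * E) - s = (p * d - s) * (1 - E) / (1 - (1 - p) * E)"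
      using qE by (simp add: e_def field_simps)
    also have "\<dots> > 0" using qE E sd by simp
    finally have so: "s < p * (d + e * E)" by simp
    have jump: "d + e = d + e * E + (s - p * (d + e * E))"
      using eq by (simp add: algebra_simps)
    \<comment> \<open>\<open>D\<close> increases, so its initial value decides; that value is \<open>s + (1 - p) * D (tau m)\<close>, which exceeds
      \<open>s / p\<close> because \<open>D (tau m)\<close> does.\<close>
    have uso: "u \<le> p * (d + e * exp (- \<gamma> * t))" if t: "0 \<le> t" for t
    proof -
      have "s = p * s + (1 - p) * s" by (simp add: algebra_simps)
      also have "\<dots> \<le> p * s + (1 - p) * (p * (d + e * E))"
        using so pos by (intro add_left_mono mult_left_mono) auto
      also have "\<dots> = p * (d + e)"
        by (subst jump) (simp add: algebra_simps)
      also have "\<dots> \<le> p * (d + e * exp (- \<gamma> * t))"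
        using e \<gamma> t pos by (intro mult_left_mono add_left_mono) (auto simp: mult_le_cancel_left1)
      finally show ?thesis using pos by simp
    qed
    have "fits d e \<gamma>"
      unfolding fits_def E_def[symmetric]
    proof (intro conjI allI impI)
      fix t assume t: "0 \<le> t" "t \<le> tau m"
      let ?D = "d + e * exp (- \<gamma> * t)"
      have "min 0 (u - p * ?D) = u - p * ?D" using uso[OF t(1)] by simp
      moreover have "\<kappa> - M * ?D + l * (u - p * ?D) = \<gamma> * d - \<gamma> * ?D"
        by (simp only: \<gamma>d) (simp add: \<gamma>_def algebra_simps)
      ultimately show "\<gamma> * (d - ?D) = \<kappa> - M * ?D + l * min 0 (u - p * ?D)"
        by (simp only: right_diff_distrib)
      show "if pm_uso then u \<le> p * ?D else p * ?D \<le> u"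
        using uso[OF t(1)] so_imp_uso[OF 3] by simp
    qed (use jump so 3 in auto)
    then show ?thesis using \<gamma> by (rule optimal)
  qed
qed

end
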